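(* Let $P\in\mathbb{H}[X_1,\dots,X_n]$ be any quaternionic polynomial with right coefficients, $$P(x_1,\dots,x_n)=\sum_{k=0}^{d}\sum_{|\ell|=k}x^\ell a_\ell=\sum_{k=0}^{d}\sum_{|\ell|=k}x_1^{\ell_1}\cdots x_n^{\ell_n}a_\ell,$$ where $\ell=(\ell_1,\dots,\ell_n)\in\mathbb{N}^n$ are multi-indices, $|\ell|=\ell_1+\dots+\ell_n$ and $a_\ell\in\mathbb{H}$. Then for every $H\in\mathcal{P}(n)$ and $K\subset H$ $$\mathcal{S}^H_K(P)(x)=\sum_{k=0}^{d}\sum_{|\ell|=k}\ \prod_{j\in H}\tilde{\mathcal{Z}}_{\ell_j-1+\chi_K(j)}(x_j)\prod_{i\in H^c}x_i^{\ell_i}\,a_\ell,$$ where $\prod_{i\in H^c}x_i^{\ell_i}$ is the ordered product (increasing $i$) and $\chi_K$ is the characteristic function of $K$.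
   Context: Sets and products. $\mathbb{H}$ denotes the quaternions, $\mathbb{S}_\mathbb{H}=\{J\in\mathbb{H}: J^2=-1\}$, $\mathcal{P}(n)$ is the power set of $\{1,\dots,n\}$, and $H^c=\{1,\dots,n\}\setminus H$. For $K=\{k_1<\dots<k_p\}$ and quaternions $q_k$, $q_K:=q_{k_1}\cdots q_{k_p}$ (increasing order), $q_\emptyset:=1$. For $z\in\mathbb{C}^n$ write $z_h=\alpha_h+i\beta_h$ with $\alpha_h,\beta_h\in\mathbb{R}$, and let $\overline z^h$ be $z$ with $z_h$ replaced by $\overline{z_h}$. Stem and slice functions. $D\subset\mathbb{C}^n$ is invariant if $z\in D\iff\overline z^h\in D$ for all $h$. Let $\{e_K\}_{K\in\mathcal{P}(n)}$ be a basis of $\mathbb{R}^{2^n}$, $e_\emptyset=1$, $e_h:=e_{\{h\}}$. A stem function on $D$ is a continuous $F=\sum_{K\in\mathcal{P}(n)}e_KF_K:D\to\mathbb{H}\otimes\mathbb{R}^{2^n}$ ($F_K$ $\mathbb{H}$-valued) with $F_K(\overline z^h)=(-1)^{|K\cap\{h\}|}F_K(z)$ for all $K,h$. The circularization of $D$ is $\Omega_D=\{(\alpha_1+J_1\beta_1,\dots,\alpha_n+J_n\beta_n): (\alpha_1+i\beta_1,\dots,\alpha_n+i\beta_n)\in D,\ J_1,\dots,J_n\in\mathbb{S}_\mathbb{H}\}$. $F$ induces the slice function $f=\mathcal{I}(F):\Omega_D\to\mathbb{H}$, $f(x)=\sum_{K}J_KF_K(z)$ for $x=(\alpha_h+J_h\beta_h)_h$,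 $z=(\alpha_h+i\beta_h)_h$; the stem function $F$ is determined by $f$. $\mathcal{S}(\Omega_D)$ is the set of slice functions on $\Omega_D$. Product: $(F\otimes G)(z)=\sum_{H,K}(-1)^{|H\cap K|}e_{K\Delta H}F_K(z)G_H(z)$ ($\Delta$ = symmetric difference) and $\mathcal{I}(F)\odot\mathcal{I}(G):=\mathcal{I}(F\otimes G)$. The coordinate function $x_j$ is the slice function induced by $Z_j(z)=\alpha_j+e_j\beta_j$; $x_K$ is the ordered product of the $x_k$, $k\in K$. Polynomials with right coefficients are slice functions on $\mathbb{H}^n=\Omega_{\mathbb{C}^n}$. Spherical derivatives and components. Here $D=\mathbb{C}^n$. For $H\in\mathcal{P}(n)$ let $D_H=\{z\in D:\beta_h\ne0\ \forall h\in H\}$, $\Omega_{D_H}$ its circularization, and for $f=\mathcal{I}(F)\in\mathcal{S}(\Omega_D)$ let $f'_{s,H}=\mathcal{I}(F'_H)\in\mathcal{S}(\Omega_{D_H})$, where $F'_H(z)=\big(\prod_{h\in H}\beta_h\big)^{-1}\sum_{K\subset H^c}e_KF_{K\cup H}(z)$. For $K\subset H$ define $\mathcal{S}^H_K(f):=(x_K\odot f)'_{s,H}$ on $\Omega_{D_H}$, extended continuously to all of $\mathbb{H}^n$ when $f$ is a polynomial with right coefficients; $\mathcal{S}^\emptyset_\emptyset(f)=f$. Zonal harmonics. For $k\ge0$, $\mathcal{Z}_k(x,1)$ is the real valued (solid) zonal harmonic of $\mathbb{R}^4\cong\mathbb{H}$ of degree $k$ with pole $1$: the unique homogeneous harmonic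 polynomial of degree $k$ in $x$ such that $p(1)=\int_{\mathbb{S}^3}p(\zeta)\mathcal{Z}_k(\zeta,1)\,d\sigma(\zeta)$ for every homogeneous harmonic polynomial $p$ of degree $k$ on $\mathbb{R}^4$, $\sigma$ being the normalized surface measure ($\sigma(\mathbb{S}^3)=1$). Define $\tilde{\mathcal{Z}}_k(x)=\mathcal{Z}_k(x,1)/(k+1)$ if $k\ge0$ and $\tilde{\mathcal{Z}}_{-1}(x)=0$. *)

theory Defs
  imports "HOL-Analysis.Analysis"
begin

section \<open>Quaternions\<close>

codatatype quat = Quat (qRe: real) (qIm1: real) (qIm2: real) (qIm3: real)

lemma quat_eqI [intro?]:
  "\<lbrakk>qRe x = qRe y; qIm1 x = qIm1 y; qIm2 x = qIm2 y; qIm3 x = qIm3 y\<rbrakk> \<Longrightarrow> x = y"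
  by (rule quat.expand) simp

lemma quat_eq_iff:
  "x = y \<longleftrightarrow> qRe x = qRe y \<and> qIm1 x = qIm1 y \<and> qIm2 x = qIm2 y \<and> qIm3 x = qIm3 y"
  by (auto intro: quat.expand)

instantiation quat :: ab_group_add
begin

primcorec zero_quat where
  "qRe 0 = 0" | "qIm1 0 = 0" | "qIm2 0 = 0" | "qIm3 0 = 0"

primcorec plus_quat where
  "qRe (x + y) = qRe x + qRe y"
| "qIm1 (x + y) = qIm1 x + qIm1 y"
| "qIm2 (x + y) = qIm2 x + qIm2 y"
| "qIm3 (x + y) = qIm3 x + qIm3 y"

primcorec uminus_quat where
  "qRe (- x) = - qRe x"
| "qIm1 (- x) = - qIm1 x"
| "qIm2 (- x) = - qIm2 x"
| "qIm3 (- x) = - qIm3 x"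

primcorec minus_quat where
  "qRe (x - y) = qRe x - qRe y"
| "qIm1 (x - y) = qIm1 x - qIm1 y"
| "qIm2 (x - y) = qIm2 x - qIm2 y"
| "qIm3 (x - y) = qIm3 x - qIm3 y"

instance
  by standard (simp_all add: quat_eq_iff)

end

instantiation quat :: ring_1
begin

primcorec one_quat where
  "qRe 1 = 1" | "qIm1 1 = 0" | "qIm2 1 = 0" | "qIm3 1 = 0"

primcorec times_quat where
  "qRe (x * y) = qRe x * qRe y - qIm1 x * qIm1 y - qIm2 x * qIm2 y - qIm3 x * qIm3 y"
| "qIm1 (x * y) = qRe x * qIm1 y + qIm1 x * qRe y + qIm2 x * qIm3 y - qIm3 x * qIm2 y"
| "qIm2 (x * y) = qRe x * qIm2 y - qIm1 x * qIm3 y + qIm2 x * qRe y + qIm3 x * qIm1 y"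
| "qIm3 (x * y) = qRe x * qIm3 y + qIm1 x * qIm2 y - qIm2 x * qIm1 y + qIm3 x * qRe y"

instance
  by standard (simp_all add: quat_eq_iff algebra_simps)

end

instantiation quat :: real_algebra_1
begin

primcorec scaleR_quat where
  "qRe (scaleR r x) = r * qRe x"
| "qIm1 (scaleR r x) = r * qIm1 x"
| "qIm2 (scaleR r x) = r * qIm2 x"
| "qIm3 (scaleR r x) = r * qIm3 x"

instance
  by standard (simp_all add: quat_eq_iff algebra_simps)

end

instantiation quat :: real_inner
begin

definition inner_quat :: "quat \<Rightarrow> quat \<Rightarrow> real" where
  "inner_quat x y = qRe x * qRe y + qIm1 x * qIm1 y + qIm2 x * qIm2 y + qIm3 x * qIm3 y"

definition norm_quat :: "quat \<Rightarrow> real" where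
  "norm_quat x = sqrt (inner x x)"

definition sgn_quat :: "quat \<Rightarrow> quat" where
  "sgn_quat x = x /\<^sub>R norm x"

definition dist_quat :: "quat \<Rightarrow> quat \<Rightarrow> real" where
  "dist_quat x y = norm (x - y)"

definition uniformity_quat :: "(quat \<times> quat) filter" where
  "uniformity_quat = (INF e\<in>{0<..}. principal {(x, y). dist x y < e})"

definition open_quat :: "quat set \<Rightarrow> bool" where
  "open_quat U \<longleftrightarrow> (\<forall>x\<in>U. eventually (\<lambda>(x', y). x' = x \<longrightarrow> y \<in> U) uniformity)"

instance
proof
  fix x y z :: quat and r :: real
  show "dist x y = norm (x - y)" by (rule dist_quat_def)
  show "sgn x = x /\<^sub>R norm x" by (rule sgn_quat_def)
  show "uniformity = (INF e\<in>{0<..}. principal {(x :: quat, y). dist x y < e})"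
    by (rule uniformity_quat_def)
  show "open U \<longleftrightarrow> (\<forall>x\<in>U. eventually (\<lambda>(x', y). x' = x \<longrightarrow> y \<in> U) uniformity)" for U :: "quat set"
    by (rule open_quat_def)
  show "inner x y = inner y x" by (simp add: inner_quat_def algebra_simps)
  show "inner (x + y) z = inner x z + inner y z" by (simp add: inner_quat_def algebra_simps)
  show "inner (r *\<^sub>R x) y = r * inner x y" by (simp add: inner_quat_def algebra_simps)
  show "0 \<le> inner x x" by (simp add: inner_quat_def)
  show "inner x x = 0 \<longleftrightarrow> x = 0"
    by (simp add: inner_quat_def quat_eq_iff add_nonneg_eq_0_iff)
  show "norm x = sqrt (inner x x)" by (rule norm_quat_def)
qed

end

lemma norm_mult_quat: "norm (x * y) = norm x * norm (y :: quat)"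
proof -
  have "inner (x * y) (x * y) = inner x x * inner y y"
    unfolding inner_quat_def times_quat.sel by algebra
  then show ?thesis
    by (simp add: norm_quat_def real_sqrt_mult)
qed

instantiation quat :: real_normed_div_algebra
begin

definition inverse_quat :: "quat \<Rightarrow> quat" where
  "inverse_quat x = Quat (qRe x) (- qIm1 x) (- qIm2 x) (- qIm3 x) /\<^sub>R inner x x"

definition divide_quat :: "quat \<Rightarrow> quat \<Rightarrow> quat" where
  "divide_quat x y = x * inverse y"

instance
proof
  fix x y :: quat
  show "inverse x * x = 1" "x * inverse x = 1" if "x \<noteq> 0"
  proof -
    define c where "c = Quat (qRe x) (- qIm1 x) (- qIm2 x) (- qIm3 x)"
    have *: "c * x = inner x x *\<^sub>R 1" "x * c = inner x x *\<^sub>R 1"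
      by (simp_all add: c_def quat_eq_iff inner_quat_def)
    have inv: "inverse x = c /\<^sub>R inner x x"
      by (simp only: c_def inverse_quat_def)
    from that have "inner x x \<noteq> 0"
      by (simp only: inner_eq_zero_iff not_False_eq_True)
    then show "inverse x * x = 1" "x * inverse x = 1"
      by (simp_all only: inv mult_scaleR_left mult_scaleR_right * scaleR_scaleR left_inverse
          scaleR_one not_False_eq_True)
  qed
  show "divide x y = x * inverse y" by (rule divide_quat_def)
  show "inverse (0 :: quat) = 0"
    by (simp only: inverse_quat_def inner_zero_left inverse_zero scaleR_zero_left)
  show "norm (x * y) = norm x * norm y" by (rule norm_mult_quat)
qed

end

instantiation quat :: euclidean_space
begin

definition Basis_quat :: "quat set" where
  "Basis_quat = {Quat 1 0 0 0, Quat 0 1 0 0, Quat 0 0 1 0, Quat 0 0 0 1}"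

instance
proof
  fix u v x :: quat
  show "(Basis :: quat set) \<noteq> {}" "finite (Basis :: quat set)"
    by (simp_all add: Basis_quat_def)
  show "inner u v = (if u = v then 1 else 0)" if "u \<in> Basis" "v \<in> Basis"
    using that unfolding Basis_quat_def
    by (elim insertE emptyE; simp add: inner_quat_def)
  show "(\<forall>u\<in>Basis. inner x u = 0) \<longleftrightarrow> x = 0"
    by (simp add: Basis_quat_def inner_quat_def) (auto simp: quat_eq_iff)
qed

end

section \<open>Ordered products and polynomials\<close>

definition oprod :: "'i::linorder set \<Rightarrow> ('i \<Rightarrow> 'a::monoid_mult) \<Rightarrow> 'a" where
  "oprod A q = prod_list (map q (sorted_list_of_set A))"

text \<open>
  The indices \<open>1 < \<dots> < n\<close> are the elements of an arbitrary finite linearly ordered type \<open>'n\<close>,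
  so that \<open>n\<close>-tuples are vectors over \<open>'n\<close> and subsets of the index set are the sets over \<open>'n\<close>.
\<close>

definition quat_poly ::
    "nat \<Rightarrow> (('n \<Rightarrow> nat) \<Rightarrow> quat) \<Rightarrow> quat ^ 'n::{finite,linorder} \<Rightarrow> quat" where
  "quat_poly d a x =
     (\<Sum>k=0..d. \<Sum>l | (\<Sum>i\<in>UNIV. l i) = k. oprod UNIV (\<lambda>i. (x $ i) ^ l i) * a l)"

section \<open>Stem functions and slice functions\<close>

definition imag_units :: "quat set" where
  "imag_units = {J. J\<^sup>2 = -1}"

definition cnj_at :: "'n \<Rightarrow> complex ^ 'n \<Rightarrow> complex ^ 'n" where
  "cnj_at h z = (\<chi> i. if i = h then cnj (z $ i) else z $ i)"

definition invariant_dom :: "(complex ^ 'n) set \<Rightarrow> bool" where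
  "invariant_dom D \<longleftrightarrow> (\<forall>z h. z \<in> D \<longleftrightarrow> cnj_at h z \<in> D)"

text \<open>
  \<open>\<H> \<otimes> \<real>\<^bsup>2^n\<^esup>\<close> is rendered as \<^typ>\<open>quat ^ 'n set\<close>: the component \<open>F\<^sub>K\<close> is \<open>F z $ K\<close>, and
  \<open>e\<^sub>K q\<close> is \<^term>\<open>axis K q\<close>.
\<close>

definition stem_function :: "(complex ^ 'n) set \<Rightarrow> (complex ^ 'n \<Rightarrow> quat ^ 'n set) \<Rightarrow> bool" where
  "stem_function D F \<longleftrightarrow> invariant_dom D \<and> continuous_on D F \<and>
     (\<forall>z\<in>D. \<forall>K h. F (cnj_at h z) $ K = (-1) ^ card (K \<inter> {h}) * F z $ K)"

definition slice_point :: "quat ^ 'n \<Rightarrow> complex ^ 'n \<Rightarrow> quat ^ 'n" where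
  "slice_point J z = (\<chi> h. of_real (Re (z $ h)) + J $ h * of_real (Im (z $ h)))"

definition circularization :: "(complex ^ 'n) set \<Rightarrow> (quat ^ 'n) set" where
  "circularization D = {slice_point J z | J z. z \<in> D \<and> (\<forall>h. J $ h \<in> imag_units)}"

text \<open>
  For a stem function on \<open>D\<close> the value below does not depend on the representation of \<open>x\<close>;
  it is meaningful for \<open>x\<close> in \<^term>\<open>circularization D\<close> only.
\<close>

definition slice_of ::
    "(complex ^ 'n::{finite,linorder}) set \<Rightarrow> (complex ^ 'n::{finite,linorder} \<Rightarrow> quat ^ 'n set) \<Rightarrow>
      quat ^ 'n::{finite,linorder} \<Rightarrow> quat" where
  "slice_of D F x = (THE y. \<exists>J z. z \<in> D \<and> (\<forall>h. J $ h \<in> imag_units) \<and> x = slice_point J z \<and>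
     y = (\<Sum>K\<in>UNIV. oprod K (\<lambda>k. J $ k) * F z $ K))"

text \<open>The stem function inducing \<open>f\<close>; its values on \<open>D\<close> are uniquely determined.\<close>

definition stem_of ::
    "(complex ^ 'n::{finite,linorder}) set \<Rightarrow> (quat ^ 'n::{finite,linorder} \<Rightarrow> quat) \<Rightarrow>
      complex ^ 'n::{finite,linorder} \<Rightarrow> quat ^ 'n set" where
  "stem_of D f = (SOME F. stem_function D F \<and> (\<forall>x\<in>circularization D. f x = slice_of D F x))"

definition stem_mult ::
    "(complex ^ 'n \<Rightarrow> quat ^ 'n set) \<Rightarrow> (complex ^ 'n \<Rightarrow> quat ^ 'n set) \<Rightarrow>
      complex ^ 'n \<Rightarrow> quat ^ 'n set" where
  "stem_mult F G z =
     (\<Sum>H\<in>UNIV. \<Sum>K\<in>UNIV. (-1) ^ card (H \<inter> K) *\<^sub>R axis (sym_diff K H) (F z $ K * G z $ H))"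

definition slice_mult ::
    "(complex ^ 'n::{finite,linorder}) set \<Rightarrow> (quat ^ 'n::{finite,linorder} \<Rightarrow> quat) \<Rightarrow>
      (quat ^ 'n::{finite,linorder} \<Rightarrow> quat) \<Rightarrow>
      quat ^ 'n::{finite,linorder} \<Rightarrow> quat" where
  "slice_mult D f g = slice_of D (stem_mult (stem_of D f) (stem_of D g))"

definition coord_stem :: "'n \<Rightarrow> complex ^ 'n \<Rightarrow> quat ^ 'n set" where
  "coord_stem j z = axis {} (of_real (Re (z $ j))) + axis {j} (of_real (Im (z $ j)))"

definition coord :: "'n \<Rightarrow> quat ^ 'n::{finite,linorder} \<Rightarrow> quat" where
  "coord j = slice_of UNIV (coord_stem j)"

text \<open>
  For factors in increasing order of the indices, the pointwise product of the coordinate functions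
  is the same function as their slice product.
\<close>

definition coord_prod :: "'n set \<Rightarrow> quat ^ 'n::{finite,linorder} \<Rightarrow> quat" where
  "coord_prod K x = oprod K (\<lambda>k. coord k x)"

section \<open>Spherical derivatives and components\<close>

definition nonreal_dom :: "'n set \<Rightarrow> (complex ^ 'n) set" where
  "nonreal_dom H = {z. \<forall>h\<in>H. Im (z $ h) \<noteq> 0}"

definition stem_deriv ::
    "'n set \<Rightarrow> (complex ^ 'n \<Rightarrow> quat ^ 'n set) \<Rightarrow> complex ^ 'n \<Rightarrow> quat ^ 'n set" where
  "stem_deriv H F z =
     inverse (\<Prod>h\<in>H. Im (z $ h)) *\<^sub>R (\<Sum>K\<in>Pow (- H). axis K (F z $ (K \<union> H)))"

definition spherical_deriv ::
    "'n set \<Rightarrow> (quat ^ 'n::{finite,linorder} \<Rightarrow> quat) \<Rightarrow> quat ^ 'n::{finite,linorder} \<Rightarrow> quat" where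
  "spherical_deriv H f = slice_of (nonreal_dom H) (stem_deriv H (stem_of UNIV f))"

text \<open>
  The component \<open>\<S>\<^sup>H\<^sub>K(f)\<close> is extended from the dense set
  \<^term>\<open>circularization (nonreal_dom H)\<close> by taking limits along this set.
\<close>

definition spherical_component ::
    "'n set \<Rightarrow> 'n set \<Rightarrow> (quat ^ 'n::{finite,linorder} \<Rightarrow> quat) \<Rightarrow> quat ^ 'n::{finite,linorder} \<Rightarrow> quat" where
  "spherical_component H K f x =
     (let g = spherical_deriv H (slice_mult UNIV (coord_prod K) f);
          \<Omega> = circularization (nonreal_dom H)
      in if x \<in> \<Omega> then g x else Lim (at x within \<Omega>) g)"

section \<open>Zonal harmonics\<close>

definition laplacian :: "('a::euclidean_space \<Rightarrow> real) \<Rightarrow> 'a \<Rightarrow> real" where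
  "laplacian f x = (\<Sum>b\<in>Basis. (deriv ^^ 2) (\<lambda>t. f (x + t *\<^sub>R b)) 0)"

definition homogeneous_harmonic :: "nat \<Rightarrow> ('a::euclidean_space \<Rightarrow> real) \<Rightarrow> bool" where
  "homogeneous_harmonic k p \<longleftrightarrow> real_polynomial_function p \<and>
     (\<forall>c x. p (c *\<^sub>R x) = c ^ k * p x) \<and> (\<forall>x. laplacian p x = 0)"

text \<open>
  The normalized surface measure \<open>\<sigma>\<close> of the unit sphere, as a Borel measure on the ambient space
  concentrated on the sphere: \<open>\<sigma>(A)\<close> is the relative volume of the cone over \<open>A\<close> in the unit ball.
\<close>

definition sphere_measure :: "'a::euclidean_space measure" where
  "sphere_measure = distr (uniform_measure lborel (ball 0 1)) borel sgn"

definition zonal_harmonic :: "nat \<Rightarrow> 'a::euclidean_space \<Rightarrow> 'a \<Rightarrow> real" where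
  "zonal_harmonic k x \<eta> = (THE Z. homogeneous_harmonic k Z \<and>
     (\<forall>p. homogeneous_harmonic k p \<longrightarrow> p \<eta> = (LINT \<zeta>|sphere_measure. p \<zeta> * Z \<zeta>))) x"

definition zonal_tilde :: "int \<Rightarrow> quat \<Rightarrow> real" where
  "zonal_tilde k x = (if k \<ge> 0 then zonal_harmonic (nat k) x 1 / (of_int k + 1) else 0)"

end

theory Submission
  imports Defs
begin

text \<open>
  The stem function of a polynomial is computed inside the commutative algebra
  \<open>\<real>\<^bsup>2^n\<^esup> = \<complex> \<otimes> \<dots> \<otimes> \<complex>\<close>: the monomial \<open>x\<^sup>l\<close> is induced by \<open>Z\<^sub>1\<^bsup>l1\<^esup> \<cdots> Z\<^sub>n\<^bsup>ln\<^esup>\<close>, whose component of index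
  \<open>K\<close> is the product of the numbers \<open>Im z\<^sub>i\<^bsup>li\<^esup>\<close> (\<open>i \<in> K\<close>) and \<open>Re z\<^sub>i\<^bsup>li\<^esup>\<close> (\<open>i \<notin> K\<close>). The slice product by
  \<open>x\<^sub>K\<close> therefore only raises the exponents in \<open>K\<close> by one, and the spherical derivative divides the
  factor \<open>Im z\<^sub>h\<^sup>m\<close> by \<open>Im z\<^sub>h\<close> for each \<open>h \<in> H\<close>, leaving the ordinary ordered product over the
  complement of \<open>H\<close> (\<open>spherical_deriv_poly\<close>). That stem functions may be computed in this way at all
  rests on two facts: the value of a slice function does not depend on how a point is written
  (\<open>slice_of_slice_point\<close>), and a stem function is determined by the slice function it induces
  (\<open>stem_of_eqI\<close>). The resulting expression is continuous on all of \<open>\<H>\<^sup>n\<close>, so it is also the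
  extension of the component across the points where it was not defined.

  The quotient \<open>Im z\<^sup>m / Im z\<close> is \<open>|z|\<^bsup>m-1\<^esup> U\<^bsub>m-1\<^esub>(Re z / |z|)\<close>, with \<open>U\<close> the Chebyshev polynomials of the
  second kind. As a function of the quaternion \<open>x\<close> it is \<open>spherical_chebyshev m\<close>, and what remains is
  the classical identification of \<open>k + 1\<close> times \<open>spherical_chebyshev (k + 1)\<close> with the zonal harmonic
  of degree \<open>k\<close> (\<open>zonal_harmonic_quat\<close>).

  This is proved without the Poisson kernel or polar coordinates. Right multiplications by unit
  quaternions preserve the surface measure, so the derivatives of a homogeneous polynomial along
  the vector fields \<open>x \<mapsto> x u\<close>, \<open>u \<in> {i, j, k}\<close>, have mean zero on the sphere. The sum of the squares of these three
  derivations is \<open>|x|\<^sup>2 \<Delta> - E (E + 2)\<close> with \<open>E\<close> the Euler operator, which gives the rule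
  \<open>\<integral> \<Delta> q = m (m + 2) \<integral> q\<close> for homogeneous \<open>q\<close> of degree \<open>m\<close> (\<open>integral_laplacian_sphere\<close>). Applied to
  \<open>q = p \<cdot> (Re x)\<^sup>j\<close> with \<open>p\<close> harmonic of degree \<open>k\<close>, it becomes a recursion that shows
  \<open>\<integral> p \<cdot> (Re x)\<^sup>j\<close> to be \<open>0\<close> for \<open>j < k\<close> and \<open>p(1) / (2\<^sup>k (k + 1))\<close> for \<open>j = k\<close>. On the sphere,
  \<open>spherical_chebyshev (k + 1)\<close> is \<open>2\<^sup>k (Re x)\<^sup>k\<close> plus lower powers of \<open>Re x\<close>, so the reproducing property
  follows. Uniqueness of the reproducing element is the usual argument: the difference of two
  candidates is orthogonal to itself.
\<close>

section \<open>Directional derivatives of polynomials\<close>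

definition dir_deriv :: "'a::real_normed_vector \<Rightarrow> ('a \<Rightarrow> real) \<Rightarrow> 'a \<Rightarrow> real" where
  "dir_deriv v q x = deriv (\<lambda>t. q (x + t *\<^sub>R v)) 0"

lemma continuous_on_polynomial:
  "real_polynomial_function f \<Longrightarrow> continuous_on S f"
  by (simp add: continuous_at_imp_continuous_on continuous_real_polymonial_function)

text \<open>
  The remainder is needed jointly continuous in point, direction and parameter: this makes it
  bounded on compact sets, which is what allows an identity between integrals to be differentiated
  in \<open>t\<close> below without any theorem on differentiation under the integral sign.
\<close>

lemma polynomial_expansion:
  fixes q :: "'a::real_normed_vector \<Rightarrow> real"
  assumes "real_polynomial_function q"
  shows "\<exists>D r. (\<forall>v. real_polynomial_function (\<lambda>x. D x v)) \<and> (\<forall>x. linear (D x)) \<and>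
    continuous_on UNIV (\<lambda>(x, v, t). r x v t) \<and>
    (\<forall>x v t. q (x + t *\<^sub>R v) = q x + t * D x v + t\<^sup>2 * r x v t)"
  using assms
proof induction
  case (linear f)
  then interpret bounded_linear f .
  show ?case
    by (rule exI[of _ "\<lambda>x. f"], rule exI[of _ "\<lambda>x v t. 0"])
       (auto simp: add scaleR linear_axioms case_prod_beta)
next
  case (const c)
  show ?case
    by (rule exI[of _ "\<lambda>x v. 0"], rule exI[of _ "\<lambda>x v t. 0"])
       (auto simp: case_prod_beta module_hom_zero)
next
  case (add f g)
  from add.IH obtain D r E s where
    D: "\<And>v. real_polynomial_function (\<lambda>x. D x v)" "\<And>x. linear (D x)"
      "continuous_on UNIV (\<lambda>(x, v, t). r x v t)"
      "\<And>x v t. f (x + t *\<^sub>R v) = f x + t * D x v + t\<^sup>2 * r x v t" and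
    E: "\<And>v. real_polynomial_function (\<lambda>x. E x v)" "\<And>x. linear (E x)"
      "continuous_on UNIV (\<lambda>(x, v, t). s x v t)"
      "\<And>x v t. g (x + t *\<^sub>R v) = g x + t * E x v + t\<^sup>2 * s x v t"
    by metis
  show ?case
  proof (intro exI conjI allI)
    show "real_polynomial_function (\<lambda>x. D x v + E x v)" for v
      using D E by auto
    show "linear (\<lambda>v. D x v + E x v)" for x
      using D E by (simp add: linear_compose_add)
    show "continuous_on UNIV (\<lambda>(x, v, t). r x v t + s x v t)"
      using continuous_on_add[OF D(3) E(3)] by (simp add: case_prod_beta)
    show "f (x + t *\<^sub>R v) + g (x + t *\<^sub>R v)
        = f x + g x + t * (D x v + E x v) + t\<^sup>2 * (r x v t + s x v t)" for x v t
      unfolding D(4) E(4) by (simp add: algebra_simps)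
  qed
next
  case (mult f g)
  from mult.IH obtain D r E s where
    D: "\<And>v. real_polynomial_function (\<lambda>x. D x v)" "\<And>x. linear (D x)"
      "continuous_on UNIV (\<lambda>(x, v, t). r x v t)"
      "\<And>x v t. f (x + t *\<^sub>R v) = f x + t * D x v + t\<^sup>2 * r x v t" and
    E: "\<And>v. real_polynomial_function (\<lambda>x. E x v)" "\<And>x. linear (E x)"
      "continuous_on UNIV (\<lambda>(x, v, t). s x v t)"
      "\<And>x v t. g (x + t *\<^sub>R v) = g x + t * E x v + t\<^sup>2 * s x v t"
    by metis
  \<comment> \<open>The first-order terms are jointly continuous because setting \<open>t = 1\<close> expresses them through
    the functions and the remainders.\<close>
  have cont: "continuous_on UNIV f" "continuous_on UNIV g"
    using mult.hyps by (auto intro: continuous_on_polynomial)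
  have contD: "continuous_on UNIV (\<lambda>(x, v, t::real). D x v)"
  proof -
    have "D x v = f (x + 1 *\<^sub>R v) - f x - 1\<^sup>2 * r x v 1" for x v
      unfolding D(4) by simp
    moreover have "continuous_on UNIV (\<lambda>z::'a\<times>'a\<times>real. f (fst z + 1 *\<^sub>R fst (snd z)) - f (fst z) - 1\<^sup>2 * r (fst z) (fst (snd z)) 1)"
      by (intro continuous_intros continuous_on_compose2[OF cont(1)]
        continuous_on_compose2[OF D(3), of _ "\<lambda>z. (fst z, fst (snd z), 1)", simplified]) auto
    ultimately show ?thesis by (simp add: case_prod_beta)
  qed
  have contE: "continuous_on UNIV (\<lambda>(x, v, t::real). E x v)"
  proof -
    have "E x v = g (x + 1 *\<^sub>R v) - g x - 1\<^sup>2 * s x v 1" for x v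
      unfolding E(4) by simp
    moreover have "continuous_on UNIV (\<lambda>z::'a\<times>'a\<times>real. g (fst z + 1 *\<^sub>R fst (snd z)) - g (fst z) - 1\<^sup>2 * s (fst z) (fst (snd z)) 1)"
      by (intro continuous_intros continuous_on_compose2[OF cont(2)]
        continuous_on_compose2[OF E(3), of _ "\<lambda>z. (fst z, fst (snd z), 1)", simplified]) auto
    ultimately show ?thesis by (simp add: case_prod_beta)
  qed
  show ?case
  proof (intro exI conjI allI)
    show "real_polynomial_function (\<lambda>x. D x v * g x + f x * E x v)" for v
      by (intro real_polynomial_function.intros(3,4) D E mult.hyps)
    show "linear (\<lambda>v. D x v * g x + f x * E x v)" for x
      using D(2)[of x] E(2)[of x]
      by (intro linearI) (simp_all add: linear_add linear_scale algebra_simps)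
    show "continuous_on UNIV (\<lambda>(x, v, t). D x v * E x v + f x * s x v t + r x v t * g x
        + t * (D x v * s x v t + r x v t * E x v) + t\<^sup>2 * (r x v t * s x v t))"
      using D(3) E(3) contD contE unfolding case_prod_beta
      by (intro continuous_intros continuous_on_compose2[OF cont(1)] continuous_on_compose2[OF cont(2)]) auto
    show "f (x + t *\<^sub>R v) * g (x + t *\<^sub>R v)
        = f x * g x + t * (D x v * g x + f x * E x v) + t\<^sup>2 * (D x v * E x v + f x * s x v t + r x v t * g x
        + t * (D x v * s x v t + r x v t * E x v) + t\<^sup>2 * (r x v t * s x v t))" for x v t
      unfolding D(4) E(4) power2_eq_square by algebra
  qed
qed

lemma
  fixes q :: "'a::real_normed_vector \<Rightarrow> real"
  assumes "real_polynomial_function q"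
  shows polynomial_dir_deriv: "real_polynomial_function (dir_deriv v q)"
    and linear_dir_deriv: "linear (\<lambda>v. dir_deriv v q x)"
    and taylor_dir_deriv: "\<exists>r. continuous_on UNIV (\<lambda>(x, v, t). r x v t) \<and>
      (\<forall>x v t. q (x + t *\<^sub>R v) = q x + t * dir_deriv v q x + t\<^sup>2 * r x v t)"
    and has_derivative_dir_deriv_0:
      "((\<lambda>t. q (x + t *\<^sub>R v)) has_real_derivative dir_deriv v q x) (at 0)"
proof -
  obtain D r where
    D: "\<And>v. real_polynomial_function (\<lambda>x. D x v)" "\<And>x. linear (D x)"
      "continuous_on UNIV (\<lambda>(x, v, t). r x v t)"
      "\<And>x v t. q (x + t *\<^sub>R v) = q x + t * D x v + t\<^sup>2 * r x v t"
    using polynomial_expansion[OF assms] by metis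
  have der: "((\<lambda>t. q (x + t *\<^sub>R v)) has_real_derivative D x v) (at 0)" for x v
  proof -
    have "((\<lambda>t. D x v + t * r x v t) \<longlongrightarrow> D x v + 0 * r x v 0) (at 0)"
    proof (intro tendsto_intros)
      have "continuous_on UNIV (\<lambda>t. r x v t)"
        using continuous_on_compose2[OF D(3), of UNIV "\<lambda>t. (x, v, t)"] by (simp add: continuous_on_Pair)
      then show "(r x v \<longlongrightarrow> r x v 0) (at 0)"
        by (simp add: continuous_on_def)
    qed
    then have "((\<lambda>t. (q (x + t *\<^sub>R v) - q (x + 0 *\<^sub>R v)) / (t - 0)) \<longlongrightarrow> D x v) (at 0)"
      unfolding mult_zero_left add_0_right
      by (rule Lim_transform_eventually)
         (auto simp: eventually_at_filter D(4)[of x] power2_eq_square add_divide_distrib intro!: always_eventually)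
    then show ?thesis
      by (simp add: has_field_derivative_iff)
  qed
  have eq: "dir_deriv v q x = D x v" for v x
    unfolding dir_deriv_def by (rule DERIV_imp_deriv[OF der])
  have "dir_deriv v q = (\<lambda>x. D x v)" by (rule ext) (rule eq)
  then show "real_polynomial_function (dir_deriv v q)" using D(1) by simp
  show "linear (\<lambda>v. dir_deriv v q x)" unfolding eq by (rule D(2))
  show "((\<lambda>t. q (x + t *\<^sub>R v)) has_real_derivative dir_deriv v q x) (at 0)"
    unfolding eq by (rule der)
  show "\<exists>r. continuous_on UNIV (\<lambda>(x, v, t). r x v t) \<and>
      (\<forall>x v t. q (x + t *\<^sub>R v) = q x + t * dir_deriv v q x + t\<^sup>2 * r x v t)"
    unfolding eq by (intro exI[of _ r] conjI allI D(3) D(4))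
qed

lemma has_derivative_dir_deriv:
  assumes "real_polynomial_function q"
  shows "((\<lambda>t. q (x + t *\<^sub>R v)) has_real_derivative dir_deriv v q (x + s *\<^sub>R v)) (at s)"
proof -
  have "((\<lambda>t. q ((x + s *\<^sub>R v) + t *\<^sub>R v)) has_real_derivative dir_deriv v q (x + s *\<^sub>R v)) (at (s - s))"
    unfolding diff_self by (rule has_derivative_dir_deriv_0[OF assms])
  moreover have "((\<lambda>t. t - s) has_real_derivative 1) (at s)"
    by (auto intro!: derivative_eq_intros)
  ultimately have "((\<lambda>t. q ((x + s *\<^sub>R v) + (t - s) *\<^sub>R v)) has_real_derivative dir_deriv v q (x + s *\<^sub>R v) * 1) (at s)"
    by (rule DERIV_chain2)
  then show ?thesis
    by (simp add: algebra_simps)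
qed

lemma dir_derivI:
  "((\<lambda>t. q (x + t *\<^sub>R v)) has_real_derivative d) (at 0) \<Longrightarrow> dir_deriv v q x = d"
  unfolding dir_deriv_def by (rule DERIV_imp_deriv)

lemma dir_deriv_const [simp]: "dir_deriv v (\<lambda>x. c) x = 0"
  by (simp add: dir_deriv_def)

lemma dir_deriv_bounded_linear:
  assumes "bounded_linear f"
  shows "dir_deriv v f x = f v"
proof -
  interpret bounded_linear f by fact
  show ?thesis
    by (rule dir_derivI) (auto simp: add scaleR intro!: derivative_eq_intros)
qed

lemma dir_deriv_add:
  assumes "real_polynomial_function f" "real_polynomial_function g"
  shows "dir_deriv v (\<lambda>x. f x + g x) x = dir_deriv v f x + dir_deriv v g x"
  by (intro dir_derivI DERIV_add has_derivative_dir_deriv_0 assms)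

lemma dir_deriv_diff:
  assumes "real_polynomial_function f" "real_polynomial_function g"
  shows "dir_deriv v (\<lambda>x. f x - g x) x = dir_deriv v f x - dir_deriv v g x"
  by (intro dir_derivI DERIV_diff has_derivative_dir_deriv_0 assms)

lemma dir_deriv_mult:
  assumes "real_polynomial_function f" "real_polynomial_function g"
  shows "dir_deriv v (\<lambda>x. f x * g x) x = dir_deriv v f x * g x + f x * dir_deriv v g x"
proof (rule dir_derivI)
  show "((\<lambda>t. f (x + t *\<^sub>R v) * g (x + t *\<^sub>R v)) has_real_derivative
     dir_deriv v f x * g x + f x * dir_deriv v g x) (at 0)"
    using DERIV_mult[OF has_derivative_dir_deriv_0[OF assms(1), of x v] has_derivative_dir_deriv_0[OF assms(2), of x v]]
    by (simp add: mult.commute)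
qed

lemma dir_deriv_power:
  assumes "real_polynomial_function f"
  shows "dir_deriv v (\<lambda>x. f x ^ n) x = of_nat n * f x ^ (n - 1) * dir_deriv v f x"
  by (rule dir_derivI) (auto intro!: derivative_eq_intros has_derivative_dir_deriv_0 assms)

text \<open>
  Symmetry of second derivatives is obtained by induction on the construction of the polynomial,
  where it reduces to commutativity of multiplication.
\<close>

lemma dir_deriv_commute:
  assumes "real_polynomial_function q"
  shows "dir_deriv u (dir_deriv v q) x = dir_deriv v (dir_deriv u q) x"
  using assms
proof (induction arbitrary: x)
  case (linear f)
  then have "dir_deriv w f = (\<lambda>x. f w)" for w
    by (auto simp: dir_deriv_bounded_linear)
  then show ?case by simp
next
  case (const c)
  have "dir_deriv w (\<lambda>x. c) = (\<lambda>x. 0)" for w :: 'a by auto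
  then show ?case by simp
next
  case (add f g)
  have "dir_deriv w (\<lambda>x. f x + g x) = (\<lambda>x. dir_deriv w f x + dir_deriv w g x)" for w
    by (auto simp: dir_deriv_add add.hyps)
  then show ?case
    by (simp add: dir_deriv_add add polynomial_dir_deriv)
next
  case (mult f g)
  have 1: "dir_deriv w (\<lambda>x. f x * g x) = (\<lambda>x. dir_deriv w f x * g x + f x * dir_deriv w g x)" for w
    by (auto simp: dir_deriv_mult mult.hyps)
  have 2: "dir_deriv w (dir_deriv w' (\<lambda>x. f x * g x)) x =
      dir_deriv w (dir_deriv w' f) x * g x + dir_deriv w' f x * dir_deriv w g x +
      (dir_deriv w f x * dir_deriv w' g x + f x * dir_deriv w (dir_deriv w' g) x)" for w w'
  proof -
    note p = mult.hyps polynomial_dir_deriv[OF mult.hyps(1), of w'] polynomial_dir_deriv[OF mult.hyps(2), of w']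
    show ?thesis
      unfolding 1 dir_deriv_add[OF real_polynomial_function.intros(4)[OF p(3,2)] real_polynomial_function.intros(4)[OF p(1,4)]]
        dir_deriv_mult[OF p(3,2)] dir_deriv_mult[OF p(1,4)] ..
  qed
  show ?case
    unfolding 2 mult.IH(1)[of x] mult.IH(2)[of x] by (simp only: ac_simps)
qed

lemma laplacian_polynomial:
  assumes "real_polynomial_function q"
  shows "laplacian q x = (\<Sum>b\<in>Basis. dir_deriv b (dir_deriv b q) x)"
proof -
  have "deriv (\<lambda>t. q (x + t *\<^sub>R b)) = (\<lambda>t. dir_deriv b q (x + t *\<^sub>R b))" for b
    by (rule ext) (rule DERIV_imp_deriv[OF has_derivative_dir_deriv[OF assms]])
  then have "(deriv ^^ 2) (\<lambda>t. q (x + t *\<^sub>R b)) 0 = dir_deriv b (dir_deriv b q) x" for b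
    unfolding dir_deriv_def[of b "dir_deriv b q"] by (simp add: numeral_2_eq_2)
  then show ?thesis
    unfolding laplacian_def by simp
qed

text \<open>
  Only positive factors are scaled: this is the form inherited by directional derivatives without
  a separate argument at the factor \<open>0\<close>.
\<close>

definition pos_homogeneous :: "nat \<Rightarrow> ('a::real_vector \<Rightarrow> real) \<Rightarrow> bool" where
  "pos_homogeneous m q \<longleftrightarrow> (\<forall>c>0. \<forall>x. q (c *\<^sub>R x) = c ^ m * q x)"

lemma euler_identity:
  assumes "real_polynomial_function q" "pos_homogeneous m q"
  shows "dir_deriv x q x = of_nat m * q x"
proof (rule dir_derivI)
  have "((\<lambda>t. (1 + t) ^ m * q x) has_real_derivative of_nat m * q x) (at 0)"
    by (auto intro!: derivative_eq_intros)
  moreover have "eventually (\<lambda>t. t \<in> {-1<..}) (nhds (0::real))"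
    by (rule eventually_nhds_in_open) auto
  then have "eventually (\<lambda>t. q (x + t *\<^sub>R x) = (1 + t) ^ m * q x) (nhds 0)"
  proof eventually_elim
    case (elim t)
    have "x + t *\<^sub>R x = (1 + t) *\<^sub>R x" by (simp add: scaleR_left_distrib)
    then show ?case using assms(2) elim by (simp add: pos_homogeneous_def)
  qed
  ultimately show "((\<lambda>t. q (x + t *\<^sub>R x)) has_real_derivative of_nat m * q x) (at 0)"
    by (subst DERIV_cong_ev[OF refl _ refl])
qed

text \<open>
  The factor \<open>c\<close> stays on the left so that the case \<open>m = 0\<close> is covered; derivatives along linear
  vector fields need it for every degree.
\<close>

lemma dir_deriv_scaled_point:
  assumes "real_polynomial_function q" "pos_homogeneous m q" and c: "c > 0"
  shows "c * dir_deriv v q (c *\<^sub>R x) = c ^ m * dir_deriv v q x"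
proof -
  have eq: "q (c *\<^sub>R x + t *\<^sub>R v) = c ^ m * q (x + (t / c) *\<^sub>R v)" for t
  proof -
    have "c *\<^sub>R x + t *\<^sub>R v = c *\<^sub>R (x + (t / c) *\<^sub>R v)" using c by (simp add: scaleR_right_distrib)
    then show ?thesis using assms(2) c by (simp only: pos_homogeneous_def)
  qed
  have "((\<lambda>t. c ^ m * q (x + (t / c) *\<^sub>R v)) has_real_derivative c ^ m * (dir_deriv v q x * (1 / c))) (at 0)"
    using has_derivative_dir_deriv_0[OF assms(1), of x v]
    by (intro DERIV_cmult DERIV_chain2[of "\<lambda>t. q (x + t *\<^sub>R v)" _ "\<lambda>t. t / c"] DERIV_cdivide DERIV_ident) simp
  then have "dir_deriv v q (c *\<^sub>R x) = c ^ m * (dir_deriv v q x * (1 / c))"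
    unfolding eq[symmetric] by (rule dir_derivI)
  then show ?thesis using c by simp
qed

lemma pos_homogeneous_dir_deriv:
  assumes "real_polynomial_function q" "pos_homogeneous (Suc m) q"
  shows "pos_homogeneous m (dir_deriv v q)"
  unfolding pos_homogeneous_def
proof (intro allI impI)
  fix c :: real and x
  assume c: "c > 0"
  show "dir_deriv v q (c *\<^sub>R x) = c ^ m * dir_deriv v q x"
    using dir_deriv_scaled_point[OF assms c, of v x] c by simp
qed

lemma dir_deriv_sum:
  assumes "\<And>b. b \<in> S \<Longrightarrow> real_polynomial_function (f b)"
  shows "dir_deriv v (\<lambda>x. \<Sum>b\<in>S. f b x) x = (\<Sum>b\<in>S. dir_deriv v (f b) x)"
  by (rule dir_derivI, rule DERIV_sum, rule has_derivative_dir_deriv_0, rule assms)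

lemma dir_deriv_basis:
  fixes q :: "'a::euclidean_space \<Rightarrow> real"
  assumes "real_polynomial_function q"
  shows "dir_deriv v q x = (\<Sum>b\<in>Basis. (v \<bullet> b) * dir_deriv b q x)"
proof -
  have "dir_deriv v q x = dir_deriv (\<Sum>b\<in>Basis. (v \<bullet> b) *\<^sub>R b) q x"
    by (simp add: euclidean_representation)
  also have "\<dots> = (\<Sum>b\<in>Basis. (v \<bullet> b) * dir_deriv b q x)"
  proof -
    interpret linear "\<lambda>v. dir_deriv v q x" by (rule linear_dir_deriv[OF assms])
    show ?thesis by (simp add: sum scale)
  qed
  finally show ?thesis .
qed

lemma polynomial_inner_left: "real_polynomial_function (\<lambda>x::'a::euclidean_space. x \<bullet> b)"
  by (intro real_polynomial_function.intros(1) bounded_linear_inner_left)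

lemma polynomial_inner_self: "real_polynomial_function (\<lambda>x::'a::euclidean_space. x \<bullet> x)"
  unfolding euclidean_inner[of x x for x]
  by (intro real_polynomial_function_sum real_polynomial_function.intros(4) polynomial_inner_left) simp

lemma dir_deriv_inner_self: "dir_deriv v (\<lambda>x::'a::euclidean_space. x \<bullet> x) x = 2 * (x \<bullet> v)"
  by (rule dir_derivI) (auto intro!: derivative_eq_intros simp: inner_commute inner_add inner_left_distrib)

text \<open>
  Differentiation along the vector field \<open>x \<mapsto> A x\<close> is a first-order operator with linear
  coefficients; differentiating the result once more produces one term from the coefficients and one
  from the Hessian.
\<close>

lemma
  fixes q :: "'a::euclidean_space \<Rightarrow> real"
  assumes q: "real_polynomial_function q" and A: "linear A"
  shows polynomial_linear_field: "real_polynomial_function (\<lambda>x. dir_deriv (A x) q x)"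
    and dir_deriv_linear_field:
      "dir_deriv v (\<lambda>x. dir_deriv (A x) q x) x = dir_deriv (A v) q x + dir_deriv v (dir_deriv (A x) q) x"
proof -
  let ?f = "\<lambda>b x. (A x \<bullet> b) * dir_deriv b q x"
  have eq: "(\<lambda>x. dir_deriv (A x) q x) = (\<lambda>x. \<Sum>b\<in>Basis. ?f b x)"
    by (rule ext) (rule dir_deriv_basis[OF q])
  have bl: "bounded_linear (\<lambda>x. A x \<bullet> b)" for b
    using A linear_conv_bounded_linear bounded_linear_compose[OF bounded_linear_inner_left] by blast
  have poly: "real_polynomial_function (\<lambda>x. A x \<bullet> b)" for b
    by (rule real_polynomial_function.intros(1)[OF bl])
  have pf: "real_polynomial_function (?f b)" for b
    by (intro real_polynomial_function.intros(4) poly polynomial_dir_deriv q)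
  show "real_polynomial_function (\<lambda>x. dir_deriv (A x) q x)"
    unfolding eq by (intro real_polynomial_function_sum pf) simp
  have inner: "dir_deriv v (dir_deriv (A x) q) x = (\<Sum>b\<in>Basis. (A x \<bullet> b) * dir_deriv v (dir_deriv b q) x)"
  proof -
    have "dir_deriv (A x) q = (\<lambda>y. \<Sum>b\<in>Basis. (A x \<bullet> b) * dir_deriv b q y)"
      by (rule ext) (rule dir_deriv_basis[OF q])
    moreover have "dir_deriv v (\<lambda>y. \<Sum>b\<in>Basis. (A x \<bullet> b) * dir_deriv b q y) x
        = (\<Sum>b\<in>Basis. dir_deriv v (\<lambda>y. (A x \<bullet> b) * dir_deriv b q y) x)"
      by (intro dir_deriv_sum real_polynomial_function.intros(2,4) polynomial_dir_deriv q)
    moreover have "dir_deriv v (\<lambda>y. (A x \<bullet> b) * dir_deriv b q y) x = (A x \<bullet> b) * dir_deriv v (dir_deriv b q) x" for b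
      by (subst dir_deriv_mult[OF real_polynomial_function.intros(2) polynomial_dir_deriv[OF q]]) simp
    ultimately show ?thesis by simp
  qed
  have "dir_deriv v (\<lambda>x. \<Sum>b\<in>Basis. ?f b x) x = (\<Sum>b\<in>Basis. dir_deriv v (?f b) x)"
    by (intro dir_deriv_sum pf)
  also have "\<dots> = (\<Sum>b\<in>Basis. (A v \<bullet> b) * dir_deriv b q x + (A x \<bullet> b) * dir_deriv v (dir_deriv b q) x)"
    by (subst dir_deriv_mult[OF poly polynomial_dir_deriv[OF q]]) (simp add: dir_deriv_bounded_linear[OF bl])
  also have "\<dots> = dir_deriv (A v) q x + dir_deriv v (dir_deriv (A x) q) x"
    by (simp only: sum.distrib inner flip: dir_deriv_basis[OF q])
  finally show "dir_deriv v (\<lambda>x. dir_deriv (A x) q x) x = dir_deriv (A v) q x + dir_deriv v (dir_deriv (A x) q) x"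
    unfolding eq .
qed

lemma laplacian_mult:
  assumes f: "real_polynomial_function f" and g: "real_polynomial_function g"
  shows "laplacian (\<lambda>x. f x * g x) x =
    laplacian f x * g x + f x * laplacian g x + 2 * (\<Sum>b\<in>Basis. dir_deriv b f x * dir_deriv b g x)"
proof -
  have "dir_deriv b (dir_deriv b (\<lambda>x. f x * g x)) x =
      dir_deriv b (dir_deriv b f) x * g x + f x * dir_deriv b (dir_deriv b g) x
      + 2 * (dir_deriv b f x * dir_deriv b g x)" for b
  proof -
    note p = f g polynomial_dir_deriv[OF f, of b] polynomial_dir_deriv[OF g, of b]
    have eq: "dir_deriv b (\<lambda>x. f x * g x) = (\<lambda>x. dir_deriv b f x * g x + f x * dir_deriv b g x)"
      by (rule ext) (rule dir_deriv_mult[OF f g])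
    show ?thesis
      unfolding eq dir_deriv_add[OF real_polynomial_function.intros(4)[OF p(3,2)] real_polynomial_function.intros(4)[OF p(1,4)]]
        dir_deriv_mult[OF p(3,2)] dir_deriv_mult[OF p(1,4)] by simp
  qed
  then show ?thesis
    using f g by (simp add: laplacian_polynomial real_polynomial_function.intros(4) sum.distrib
        sum_distrib_left sum_distrib_right)
qed

lemma laplacian_add:
  assumes f: "real_polynomial_function f" and g: "real_polynomial_function g"
  shows "laplacian (\<lambda>x. f x + g x) x = laplacian f x + laplacian g x"
proof -
  have eq: "dir_deriv b (\<lambda>x. f x + g x) = (\<lambda>x. dir_deriv b f x + dir_deriv b g x)" for b
    by (rule ext) (rule dir_deriv_add[OF f g])
  then show ?thesis
    by (simp add: laplacian_polynomial[OF f] laplacian_polynomial[OF g] laplacian_polynomial[OF real_polynomial_function.intros(3)[OF f g]]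
        dir_deriv_add[OF polynomial_dir_deriv[OF f] polynomial_dir_deriv[OF g]] sum.distrib)
qed

lemma laplacian_dir_deriv:
  assumes q: "real_polynomial_function q" and harm: "\<And>x. laplacian q x = 0"
  shows "laplacian (dir_deriv v q) x = 0"
proof -
  have "dir_deriv b (dir_deriv b (dir_deriv v q)) x = dir_deriv v (dir_deriv b (dir_deriv b q)) x" for b
  proof -
    have "dir_deriv b (dir_deriv v q) = dir_deriv v (dir_deriv b q)"
      by (rule ext) (rule dir_deriv_commute[OF q])
    then show ?thesis
      by (simp only: dir_deriv_commute[OF polynomial_dir_deriv[OF q]])
  qed
  then have "laplacian (dir_deriv v q) x = (\<Sum>b\<in>Basis. dir_deriv v (dir_deriv b (dir_deriv b q)) x)"
    by (simp add: laplacian_polynomial[OF polynomial_dir_deriv[OF q]])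
  also have "\<dots> = dir_deriv v (\<lambda>x. \<Sum>b\<in>Basis. dir_deriv b (dir_deriv b q) x) x"
    by (intro dir_deriv_sum[symmetric] polynomial_dir_deriv q)
  also have "(\<lambda>x. \<Sum>b\<in>Basis. dir_deriv b (dir_deriv b q) x) = (\<lambda>x. 0)"
    using harm by (simp add: laplacian_polynomial[OF q])
  finally show ?thesis by simp
qed


section \<open>The surface measure and its invariance under right multiplication\<close>

lemma distr_lborel_orthogonal:
  fixes f :: "real ^ 'n::{finite,wellorder} \<Rightarrow> real ^ 'n::_"
  assumes f: "orthogonal_transformation f"
  shows "distr lborel borel f = lborel"
proof (rule lborel_eqI[symmetric])
  fix l u :: "real ^ 'n::_"
  assume lu: "\<And>b. b \<in> Basis \<Longrightarrow> l \<bullet> b \<le> u \<bullet> b"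
  have bij: "bij f" by (rule orthogonal_transformation_bij[OF f])
  have inv: "orthogonal_transformation (inv f)" by (rule orthogonal_transformation_inv[OF f])
  have cont: "continuous_on UNIV f"
    using orthogonal_transformation_linear[OF f] by (rule linear_continuous_on_compose[OF continuous_on_id])
  have meas: "f \<in> borel_measurable borel" by (rule borel_measurable_continuous_onI[OF cont])
  have pre: "f -` box l u = inv f ` box l u" by (rule bij_vimage_eq_inv_image[OF bij])
  have opn: "open (f -` box l u)" by (rule open_vimage[OF open_box cont])
  have lm: "box l u \<in> lmeasurable" by simp
  have "emeasure (distr lborel borel f) (box l u) = emeasure lborel (f -` box l u)"
    using meas by (simp add: emeasure_distr)
  also have "\<dots> = emeasure lebesgue (inv f ` box l u)"
    using opn pre by simp
  also have "\<dots> = ennreal (measure lebesgue (inv f ` box l u))"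
    using measurable_orthogonal_image[OF inv lm] by (simp add: emeasure_eq_measure2)
  also have "measure lebesgue (inv f ` box l u) = measure lebesgue (box l u)"
    by (rule measure_orthogonal_image[OF inv lm])
  also have "ennreal \<dots> = emeasure lborel (box l u)"
    using lm by (simp add: emeasure_eq_measure2 flip: emeasure_completion)
  finally show "emeasure (distr lborel borel f) (box l u) = (\<Prod>b\<in>Basis. (u - l) \<bullet> b)"
    using lu by (simp add: emeasure_lborel_box_eq)
qed simp

text \<open>
  The isometry with \<open>\<real>\<^sup>4\<close> along which the invariance of Lebesgue measure under orthogonal maps is
  transported to the quaternions.
\<close>

definition quat_of_vec :: "real ^ 4 \<Rightarrow> quat" where
  "quat_of_vec v = Quat (v $ 1) (v $ 2) (v $ 3) (v $ 4)"

definition vec_of_quat :: "quat \<Rightarrow> real ^ 4" where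
  "vec_of_quat q = vector [qRe q, qIm1 q, qIm2 q, qIm3 q]"

lemma vec_of_quat_nth [simp]:
  "vec_of_quat q $ 1 = qRe q" "vec_of_quat q $ 2 = qIm1 q"
  "vec_of_quat q $ 3 = qIm2 q" "vec_of_quat q $ 4 = qIm3 q"
  by (simp_all add: vec_of_quat_def vector_def)

lemma quat_of_vec_of_quat [simp]: "quat_of_vec (vec_of_quat q) = q"
  by (simp add: quat_of_vec_def)

lemma linear_quat_of_vec: "linear quat_of_vec"
  by (rule linearI) (simp_all add: quat_of_vec_def quat_eq_iff)

lemma linear_vec_of_quat: "linear vec_of_quat"
  by (rule linearI) (simp_all add: vec_eq_iff forall_4)

lemma norm_quat_of_vec: "norm (quat_of_vec v) = norm v"
  by (simp add: norm_eq_sqrt_inner inner_quat_def inner_vec_def sum_4) (simp add: quat_of_vec_def)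

lemma norm_vec_of_quat: "norm (vec_of_quat q) = norm q"
  by (metis norm_quat_of_vec quat_of_vec_of_quat)

lemma emeasure_lborel_box_cart:
  fixes l u :: "real ^ 'n"
  assumes "\<And>i. l $ i \<le> u $ i"
  shows "emeasure lborel (box l u) = (\<Prod>i\<in>UNIV. u $ i - l $ i)"
proof -
  have B: "(Basis :: (real ^ 'n) set) = range (\<lambda>i. axis i 1)"
    by (auto simp: Basis_vec_def)
  have "emeasure lborel (box l u) = (\<Prod>b\<in>Basis. (u - l) \<bullet> b)"
    using assms by (intro emeasure_lborel_box) (auto simp: B inner_axis)
  also have "(\<Prod>b\<in>Basis. (u - l) \<bullet> b) = (\<Prod>i\<in>UNIV. u $ i - l $ i)"
    unfolding B by (subst prod.reindex) (auto simp: inj_on_def axis_eq_axis inner_axis)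
  finally show ?thesis .
qed

lemma borel_measurable_linear:
  fixes f :: "'a::euclidean_space \<Rightarrow> 'b::euclidean_space"
  assumes "linear f"
  shows "f \<in> borel_measurable borel"
  by (intro borel_measurable_continuous_onI linear_continuous_on_compose[OF continuous_on_id] assms)

lemma distr_lborel_quat_of_vec: "distr lborel borel quat_of_vec = lborel"
proof (rule lborel_eqI[symmetric])
  fix l u :: quat
  assume lu: "\<And>b. b \<in> Basis \<Longrightarrow> l \<bullet> b \<le> u \<bullet> b"
  have lu': "qRe l \<le> qRe u" "qIm1 l \<le> qIm1 u" "qIm2 l \<le> qIm2 u" "qIm3 l \<le> qIm3 u"
    using lu[of "Quat 1 0 0 0"] lu[of "Quat 0 1 0 0"] lu[of "Quat 0 0 1 0"] lu[of "Quat 0 0 0 1"]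
    by (simp_all add: Basis_quat_def inner_quat_def)
  have pre: "quat_of_vec -` box l u = box (vec_of_quat l) (vec_of_quat u)"
  proof -
    have "q \<in> box l u \<longleftrightarrow> qRe l < qRe q \<and> qRe q < qRe u \<and> qIm1 l < qIm1 q \<and> qIm1 q < qIm1 u \<and>
        qIm2 l < qIm2 q \<and> qIm2 q < qIm2 u \<and> qIm3 l < qIm3 q \<and> qIm3 q < qIm3 u" for q
      by (auto simp: mem_box Basis_quat_def inner_quat_def)
    then show ?thesis
      by (intro set_eqI) (simp only: vimage_eq mem_box_cart forall_4 vec_of_quat_nth quat_of_vec_def quat.sel conj_assoc)
  qed
  have "emeasure (distr lborel borel quat_of_vec) (box l u) = emeasure lborel (box (vec_of_quat l) (vec_of_quat u))"
    using borel_measurable_linear[OF linear_quat_of_vec] by (simp add: emeasure_distr pre)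
  also have "\<dots> = (\<Prod>i\<in>UNIV. vec_of_quat u $ i - vec_of_quat l $ i)"
  proof (rule emeasure_lborel_box_cart)
    fix i :: 4
    show "vec_of_quat l $ i \<le> vec_of_quat u $ i"
      using lu' exhaust_4[of i] by auto
  qed
  also have "(\<Prod>i\<in>UNIV. vec_of_quat u $ i - vec_of_quat l $ i) = (\<Prod>b\<in>Basis. (u - l) \<bullet> b)"
    unfolding UNIV_4 Basis_quat_def by (simp add: inner_quat_def)
  finally show "emeasure (distr lborel borel quat_of_vec) (box l u) = (\<Prod>b\<in>Basis. (u - l) \<bullet> b)" .
qed simp

lemma distr_lborel_quat_isometry:
  fixes T :: "quat \<Rightarrow> quat"
  assumes T: "linear T" "\<And>x. norm (T x) = norm x"
  shows "distr lborel borel T = lborel"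
proof -
  let ?T = "vec_of_quat \<circ> T \<circ> quat_of_vec"
  have orth: "orthogonal_transformation ?T"
    unfolding orthogonal_transformation
    by (auto intro!: linear_compose linear_quat_of_vec linear_vec_of_quat T simp: norm_vec_of_quat T norm_quat_of_vec)
  have Tq: "T \<circ> quat_of_vec = quat_of_vec \<circ> ?T"
    by (simp add: fun_eq_iff)
  note meas = borel_measurable_linear[OF T(1)] borel_measurable_linear[OF linear_quat_of_vec]
    borel_measurable_linear[OF orthogonal_transformation_linear[OF orth]]
  have "distr lborel borel T = distr (distr lborel borel quat_of_vec) borel T"
    by (simp add: distr_lborel_quat_of_vec)
  also have "\<dots> = distr lborel borel (T \<circ> quat_of_vec)"
    using meas by (simp add: distr_distr)
  also have "\<dots> = distr (distr lborel borel ?T) borel quat_of_vec"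
    unfolding Tq using meas by (subst distr_distr) simp_all
  also have "\<dots> = lborel"
    by (simp only: distr_lborel_orthogonal[OF orth] distr_lborel_quat_of_vec)
  finally show ?thesis .
qed

lemma sets_sphere_measure [simp, measurable_cong]: "sets sphere_measure = sets borel"
  and space_sphere_measure [simp]: "space sphere_measure = UNIV"
  by (simp_all add: sphere_measure_def)

lemma borel_measurable_sgn_euclidean [measurable]:
  "(sgn :: 'a::euclidean_space \<Rightarrow> 'a) \<in> borel_measurable borel"
  unfolding sgn_div_norm[abs_def] by measurable

lemma emeasure_unit_ball_pos: "emeasure lborel (ball 0 1 :: 'a::euclidean_space set) \<noteq> 0"
proof
  assume "emeasure lborel (ball 0 1 :: 'a set) = 0"
  then have "measure lborel (ball (0::'a) 1) = 0" unfolding measure_def by simp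
  with content_ball_pos[of 1 "0::'a"] show False by simp
qed

lemma emeasure_unit_ball_finite: "emeasure lborel (ball 0 1 :: 'a::euclidean_space set) < \<infinity>"
  by (rule emeasure_bounded_finite) (rule bounded_ball)

lemma emeasure_sphere_measure_UNIV:
  "emeasure (sphere_measure :: 'a::euclidean_space measure) UNIV = 1"
  using emeasure_unit_ball_pos[where 'a = 'a] emeasure_unit_ball_finite[where 'a = 'a]
  by (simp add: sphere_measure_def emeasure_distr)

lemma finite_measure_sphere_measure:
  "finite_measure (sphere_measure :: 'a::euclidean_space measure)"
  by (rule finite_measureI) (simp add: emeasure_sphere_measure_UNIV)

lemma AE_sphere_measure_iff:
  fixes P :: "'a::euclidean_space \<Rightarrow> bool"
  assumes [measurable]: "Measurable.pred borel P"
  shows "(AE z in sphere_measure. P z) \<longleftrightarrow> (AE x in lborel. x \<in> ball 0 1 \<longrightarrow> P (sgn x))"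
  unfolding sphere_measure_def
  by (subst AE_distr_iff) (simp_all add: AE_uniform_measure[OF emeasure_unit_ball_pos emeasure_unit_ball_finite] del: mem_ball)

text \<open>
  The centre of the ball is the only point that radial projection does not send to the sphere, and
  it is a null set.
\<close>

lemma AE_norm_sphere_measure:
  "AE z in (sphere_measure :: 'a::euclidean_space measure). norm z = 1"
proof (subst AE_sphere_measure_iff)
  have "AE x in lborel. x \<noteq> (0::'a)" by (rule AE_lborel_singleton)
  then show "AE x in lborel. x \<in> ball 0 1 \<longrightarrow> norm (sgn x :: 'a) = 1"
    by eventually_elim (simp add: norm_sgn)
qed measurable

lemma integrable_sphere_measure:
  fixes f :: "'a::euclidean_space \<Rightarrow> real"
  assumes "continuous_on UNIV f"
  shows "integrable sphere_measure f"
proof -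
  have "compact (f ` cball 0 1)"
    by (intro compact_continuous_image continuous_on_subset[OF assms]) auto
  then obtain B where B: "\<And>x. x \<in> cball 0 1 \<Longrightarrow> norm (f x) \<le> B"
    using compact_imp_bounded bounded_iff by (metis imageI)
  show ?thesis
  proof (rule finite_measure.integrable_const_bound[OF finite_measure_sphere_measure])
    show "AE x in sphere_measure. norm (f x) \<le> B"
      using AE_norm_sphere_measure by eventually_elim (rule B, simp)
    show "f \<in> borel_measurable sphere_measure"
      using borel_measurable_continuous_onI[OF assms] by simp
  qed
qed

text \<open>
  A linear isometry preserves the unit ball and Lebesgue measure, and it commutes with the radial
  projection that defines the surface measure.
\<close>

lemma sphere_measure_isometry:
  fixes T :: "quat \<Rightarrow> quat"
  assumes T: "linear T" "\<And>x. norm (T x) = norm x"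
  shows "distr sphere_measure borel T = sphere_measure"
proof -
  let ?U = "uniform_measure lborel (ball 0 1) :: quat measure"
  have meas [measurable]: "T \<in> borel_measurable borel" by (rule borel_measurable_linear[OF T(1)])
  have U: "distr ?U borel T = ?U"
  proof (rule measure_eqI)
    fix A assume "A \<in> sets (distr ?U borel T)"
    then have A [measurable]: "A \<in> sets borel" by simp
    have [measurable]: "T -` A \<in> sets borel" using measurable_sets[OF meas A] by simp
    have "emeasure (distr ?U borel T) A = emeasure lborel (ball 0 1 \<inter> T -` A) / emeasure lborel (ball (0::quat) 1)"
      by (simp add: emeasure_distr)
    also have "ball 0 1 \<inter> T -` A = T -` (ball 0 1 \<inter> A)"
      using T(2) by auto
    also have "emeasure lborel \<dots> = emeasure (distr lborel borel T) (ball 0 1 \<inter> A)"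
      by (simp add: emeasure_distr)
    also have "\<dots> = emeasure lborel (ball 0 1 \<inter> A)"
      by (simp add: distr_lborel_quat_isometry[OF T])
    finally show "emeasure (distr ?U borel T) A = emeasure ?U A"
      by simp
  qed simp
  have comm: "T \<circ> sgn = sgn \<circ> T"
    using T by (auto simp: fun_eq_iff sgn_div_norm linear_scale)
  have "distr sphere_measure borel T = distr ?U borel (T \<circ> sgn)"
    unfolding sphere_measure_def by (simp add: distr_distr)
  also have "\<dots> = distr (distr ?U borel T) borel sgn"
    unfolding comm by (simp add: distr_distr)
  also have "\<dots> = sphere_measure"
    unfolding U sphere_measure_def ..
  finally show ?thesis .
qed

lemma integral_sphere_measure_mult_right:
  fixes f :: "quat \<Rightarrow> real"
  assumes "continuous_on UNIV f" "norm w = 1"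
  shows "(LINT z|sphere_measure. f (z * w)) = (LINT z|sphere_measure. f z)"
proof -
  have lin: "linear (\<lambda>z. z * w)" by (rule linearI) (simp_all add: distrib_right)
  have "(LINT z|sphere_measure. f z) = (LINT z|distr sphere_measure borel (\<lambda>z. z * w). f z)"
    using assms(2) by (simp add: sphere_measure_isometry[OF lin] norm_mult_quat)
  also have "\<dots> = (LINT z|sphere_measure. f (z * w))"
    using borel_measurable_linear[OF lin] borel_measurable_continuous_onI[OF assms(1)]
    by (subst integral_distr) simp_all
  finally show ?thesis by simp
qed


section \<open>Laplacian and means over the sphere\<close>

lemma quat_one_in_Basis: "(1::quat) \<in> Basis"
proof -
  have "(1::quat) = Quat 1 0 0 0" by (simp add: quat_eq_iff)
  then show ?thesis by (simp add: Basis_quat_def)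
qed

lemma quat_basis_squared: "u \<in> Basis \<Longrightarrow> u \<noteq> 1 \<Longrightarrow> u * u = (-1::quat)"
  unfolding Basis_quat_def by (elim insertE emptyE) (simp_all add: quat_eq_iff)

text \<open>
  For \<open>x \<noteq> 0\<close> the vectors \<open>x, x i, x j, x k\<close>, divided by \<open>|x|\<close>, form an orthonormal basis: this is
  Parseval's identity for them.
\<close>

lemma sum_right_translates:
  fixes x b c :: quat
  assumes "b \<in> Basis" "c \<in> Basis"
  shows "(\<Sum>u\<in>Basis. ((x * u) \<bullet> b) * ((x * u) \<bullet> c)) = (x \<bullet> x) * (b \<bullet> c)"
  using assms unfolding Basis_quat_def
  by (elim insertE emptyE) (simp_all add: inner_quat_def algebra_simps)

lemma hessian_basis:
  fixes q :: "'a::euclidean_space \<Rightarrow> real"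
  assumes q: "real_polynomial_function q"
  shows "dir_deriv v (dir_deriv v q) x = (\<Sum>b\<in>Basis. \<Sum>c\<in>Basis. (v \<bullet> b) * (v \<bullet> c) * dir_deriv b (dir_deriv c q) x)"
proof -
  have eq: "dir_deriv v q = (\<lambda>x. \<Sum>c\<in>Basis. (v \<bullet> c) * dir_deriv c q x)"
    by (rule ext) (rule dir_deriv_basis[OF q])
  have "dir_deriv b (\<lambda>x. (v \<bullet> c) * dir_deriv c q x) x = (v \<bullet> c) * dir_deriv b (dir_deriv c q) x" for b c
    by (subst dir_deriv_mult[OF real_polynomial_function.intros(2) polynomial_dir_deriv[OF q]]) simp
  then have "dir_deriv b (dir_deriv v q) x = (\<Sum>c\<in>Basis. (v \<bullet> c) * dir_deriv b (dir_deriv c q) x)" for b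
    unfolding eq
    by (subst dir_deriv_sum) (intro real_polynomial_function.intros(2,4) polynomial_dir_deriv q, simp)
  then show ?thesis
    by (subst dir_deriv_basis[OF polynomial_dir_deriv[OF q]]) (simp add: sum_distrib_left mult.assoc)
qed

text \<open>
  The Laplacian is the trace of the Hessian and may be computed in the orthogonal basis
  \<open>x, x i, x j, x k\<close>, all of whose members have length \<open>|x|\<close>.
\<close>

lemma sum_hessian_right_translates:
  assumes q: "real_polynomial_function q"
  shows "(\<Sum>u\<in>Basis. dir_deriv (x * u) (dir_deriv (x * u) q) x) = (x \<bullet> x) * laplacian q (x::quat)"
proof -
  have "(\<Sum>u\<in>Basis. dir_deriv (x * u) (dir_deriv (x * u) q) x) =
      (\<Sum>b\<in>Basis. \<Sum>c\<in>Basis. (\<Sum>u\<in>Basis. ((x * u) \<bullet> b) * ((x * u) \<bullet> c)) * dir_deriv b (dir_deriv c q) x)"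
    unfolding hessian_basis[OF q] sum_distrib_right
    by (subst sum.swap) (intro sum.cong refl sum.swap)
  also have "\<dots> = (\<Sum>b\<in>Basis. \<Sum>c\<in>Basis. (x \<bullet> x) * (b \<bullet> c) * dir_deriv b (dir_deriv c q) x)"
    by (intro sum.cong refl) (simp only: sum_right_translates)
  also have "\<dots> = (\<Sum>b\<in>Basis. \<Sum>c\<in>Basis. if c = b then (x \<bullet> x) * dir_deriv b (dir_deriv b q) x else 0)"
    by (intro sum.cong refl) (simp add: inner_Basis)
  also have "\<dots> = (x \<bullet> x) * laplacian q x"
    by (simp add: laplacian_polynomial[OF q] sum_distrib_left)
  finally show ?thesis .
qed

text \<open>
  The left-invariant vector field generated by \<open>u\<close>: its flow is \<open>x \<mapsto> x exp (t u)\<close>, which for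
  imaginary \<open>u\<close> consists of rotations.
\<close>

definition right_field :: "quat \<Rightarrow> (quat \<Rightarrow> real) \<Rightarrow> quat \<Rightarrow> real" where
  "right_field u q x = dir_deriv (x * u) q x"

lemma linear_mult_right: "linear (\<lambda>x::quat. x * u)"
  by (rule linearI) (simp_all add: distrib_right)

lemma polynomial_right_field:
  "real_polynomial_function q \<Longrightarrow> real_polynomial_function (right_field u q)"
  unfolding right_field_def[abs_def] by (rule polynomial_linear_field[OF _ linear_mult_right])

lemma pos_homogeneous_right_field:
  assumes q: "real_polynomial_function q" "pos_homogeneous m q"
  shows "pos_homogeneous m (right_field u q)"
  unfolding pos_homogeneous_def right_field_def
proof (intro allI impI)
  fix c :: real and x :: quat
  assume c: "c > 0"
  have "dir_deriv (c *\<^sub>R x * u) q (c *\<^sub>R x) = c * dir_deriv (x * u) q (c *\<^sub>R x)"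
    using linear_scale[OF linear_dir_deriv[OF q(1), of "c *\<^sub>R x"], of c "x * u"] by simp
  also have "\<dots> = c ^ m * dir_deriv (x * u) q x"
    by (rule dir_deriv_scaled_point[OF q c])
  finally show "dir_deriv (c *\<^sub>R x * u) q (c *\<^sub>R x) = c ^ m * dir_deriv (x * u) q x" .
qed

lemma right_field_twice:
  assumes q: "real_polynomial_function q"
  shows "right_field u (right_field u q) x = dir_deriv (x * (u * u)) q x + dir_deriv (x * u) (dir_deriv (x * u) q) x"
  unfolding right_field_def[abs_def]
  by (subst dir_deriv_linear_field[OF q linear_mult_right]) (simp add: mult.assoc)

text \<open>
  Since \<open>u\<^sup>2 = -1\<close>, each square contributes \<open>-E\<close> and the second derivative in direction \<open>x u\<close>. These
  second derivatives add up to \<open>|x|\<^sup>2 \<Delta> q\<close> minus the radial one, which is \<open>m (m - 1) q\<close> by applying Euler's identity twice.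
\<close>

lemma casimir_right_field:
  assumes q: "real_polynomial_function q" "pos_homogeneous m q"
  shows "(\<Sum>u\<in>Basis - {1}. right_field u (right_field u q) x) =
    (x \<bullet> x) * laplacian q x - m * (m + 2) * q x"
proof -
  have E: "right_field 1 q = (\<lambda>x. m * q x)"
    by (auto simp: right_field_def euler_identity[OF q])
  have hess: "dir_deriv x (dir_deriv x q) x = real m * real m * q x - real m * q x"
  proof -
    have "right_field 1 (right_field 1 q) x = m * (m * q x)"
      unfolding E by (simp add: right_field_def dir_deriv_mult[OF real_polynomial_function.intros(2) q(1)] euler_identity[OF q])
    then show ?thesis
      by (simp add: right_field_twice[OF q(1)] euler_identity[OF q])
  qed
  have neg: "dir_deriv (- x) q x = - (m * q x)"
    using linear_neg[OF linear_dir_deriv[OF q(1), of x], of x] by (simp add: euler_identity[OF q])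
  have "(\<Sum>u\<in>Basis - {1}. right_field u (right_field u q) x) =
      (\<Sum>u\<in>Basis - {1::quat}. - (m * q x)) + (\<Sum>u\<in>Basis - {1}. dir_deriv (x * u) (dir_deriv (x * u) q) x)"
    unfolding sum.distrib[symmetric]
    by (intro sum.cong refl) (simp add: right_field_twice[OF q(1)] quat_basis_squared neg)
  also have "(\<Sum>u\<in>Basis - {1::quat}. - (m * q x)) = - 3 * m * q x"
  proof -
    have "card (Basis :: quat set) = 4"
      by (simp add: Basis_quat_def)
    then show ?thesis using quat_one_in_Basis by simp
  qed
  also have "(\<Sum>u\<in>Basis - {1}. dir_deriv (x * u) (dir_deriv (x * u) q) x) =
      (x \<bullet> x) * laplacian q x - (real m * real m * q x - real m * q x)"
    using sum_hessian_right_translates[OF q(1), of x] hess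
    by (simp add: sum.remove[OF finite_Basis quat_one_in_Basis])
  finally show ?thesis by (simp add: algebra_simps)
qed

text \<open>
  The elements \<open>1 + t u\<close> and \<open>1 - t u\<close> have the same norm. By homogeneity and invariance of the measure,
  the means of \<open>q (z (1 + t u))\<close> and \<open>q (z (1 - t u))\<close> agree, so the term of first order in \<open>t\<close> is
  bounded by a multiple of \<open>t\<^sup>2\<close>.
\<close>

lemma integral_right_field:
  assumes q: "real_polynomial_function q" "pos_homogeneous m q" and u: "u * u = -1"
  shows "(LINT z|sphere_measure. right_field u q z) = 0"
proof -
  obtain r where r: "continuous_on UNIV (\<lambda>(x, v, t). r x v t)"
    and taylor: "\<And>x v t. q (x + t *\<^sub>R v) = q x + t * dir_deriv v q x + t\<^sup>2 * r x v t"
    using taylor_dir_deriv[OF q(1)] by metis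
  have cont_q: "continuous_on UNIV q" by (rule continuous_on_polynomial[OF q(1)])
  have cont_R: "continuous_on UNIV (right_field u q)"
    by (rule continuous_on_polynomial[OF polynomial_right_field[OF q(1)]])
  have cont_r: "continuous_on UNIV (\<lambda>z. r z (z * u) t)" for t
    by (rule continuous_on_compose2[OF r, of UNIV "\<lambda>z. (z, z * u, t)", simplified])
       (intro continuous_intros)
  have cont_rem: "continuous_on UNIV (\<lambda>y. r (fst y) (fst y * u) (snd y))"
    by (rule continuous_on_compose2[OF r, of UNIV "\<lambda>y. (fst y, fst y * u, snd y)", simplified])
       (intro continuous_intros)
  have "compact ((\<lambda>y. r (fst y) (fst y * u) (snd y)) ` (cball 0 1 \<times> {-1..1}))"
    by (intro compact_continuous_image continuous_on_subset[OF cont_rem] compact_Times) auto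
  then obtain B where B': "\<And>w. w \<in> (\<lambda>y. r (fst y) (fst y * u) (snd y)) ` (cball 0 1 \<times> {-1..1}) \<Longrightarrow> norm w \<le> B"
    using compact_imp_bounded bounded_iff by metis
  have B: "\<bar>r z (z * u) t\<bar> \<le> B" if "z \<in> cball 0 1" "t \<in> {-1..1}" for z t
    using B'[OF imageI, of "(z, t)"] that by simp
  let ?I = "LINT z|sphere_measure. right_field u q z"
  let ?r = "\<lambda>t. LINT z|sphere_measure. r z (z * u) t"
  have bound_r: "\<bar>?r t\<bar> \<le> B" if t: "t \<in> {-1..1}" for t
  proof -
    have "\<bar>?r t\<bar> \<le> (LINT z|sphere_measure. \<bar>r z (z * u) t\<bar>)" by (rule integral_abs_bound)
    also have "\<dots> \<le> (LINT z|(sphere_measure :: quat measure). B)"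
    proof (rule integral_mono_AE)
      show "integrable sphere_measure (\<lambda>z. \<bar>r z (z * u) t\<bar>)"
        by (intro integrable_abs integrable_sphere_measure cont_r)
      show "AE z in sphere_measure. \<bar>r z (z * u) t\<bar> \<le> B"
        using AE_norm_sphere_measure by eventually_elim (use t in \<open>auto intro: B\<close>)
    qed (auto intro!: integrable_sphere_measure)
    also have "\<dots> = B"
      by (simp add: measure_def emeasure_sphere_measure_UNIV)
    finally show ?thesis .
  qed
  have val: "(LINT z|sphere_measure. q (z * (1 + t *\<^sub>R u))) = norm (1 + t *\<^sub>R u) ^ m * (LINT z|sphere_measure. q z)" for t
  proof -
    let ?n = "norm (1 + t *\<^sub>R u)"
    have n: "?n > 0"
    proof -
      have "1 + t *\<^sub>R u \<noteq> 0"
      proof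
        assume "1 + t *\<^sub>R u = 0"
        then have "t *\<^sub>R u = -1" by (simp add: eq_neg_iff_add_eq_0 add.commute)
        then have "(t *\<^sub>R u) * (t *\<^sub>R u) = 1" by simp
        then have "(t * t) *\<^sub>R (- 1 :: quat) = 1" by (simp add: u)
        then have "- (t * t) = (1::real)" by (simp add: quat_eq_iff)
        then show False by (smt (verit) zero_le_square)
      qed
      then show ?thesis by simp
    qed
    have "q (z * (1 + t *\<^sub>R u)) = ?n ^ m * q (z * sgn (1 + t *\<^sub>R u))" for z
    proof -
      have "z * (1 + t *\<^sub>R u) = ?n *\<^sub>R (z * sgn (1 + t *\<^sub>R u))"
        using n by (simp add: sgn_div_norm)
      then show ?thesis using q(2) n by (simp only: pos_homogeneous_def)
    qed
    then have "(LINT z|sphere_measure. q (z * (1 + t *\<^sub>R u))) = ?n ^ m * (LINT z|sphere_measure. q (z * sgn (1 + t *\<^sub>R u)))"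
      by simp
    also have "(LINT z|sphere_measure. q (z * sgn (1 + t *\<^sub>R u))) = (LINT z|sphere_measure. q z)"
      using n by (intro integral_sphere_measure_mult_right cont_q) (auto simp: norm_sgn)
    finally show ?thesis .
  qed
  have expand: "(LINT z|sphere_measure. q (z * (1 + t *\<^sub>R u))) = (LINT z|sphere_measure. q z) + t * ?I + t\<^sup>2 * ?r t" for t
  proof -
    have "q (z * (1 + t *\<^sub>R u)) = q z + t * right_field u q z + t\<^sup>2 * r z (z * u) t" for z
      using taylor[of z t "z * u"] by (simp only: right_field_def distrib_left mult_1_right mult_scaleR_right)
    moreover have "integrable sphere_measure q" "integrable sphere_measure (right_field u q)"
      "integrable sphere_measure (\<lambda>z. r z (z * u) t)"
      by (intro integrable_sphere_measure cont_q cont_R cont_r)+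
    ultimately show ?thesis by simp
  qed
  \<comment> \<open>As \<open>u\<close> squares to \<open>-1\<close> it is purely imaginary, hence orthogonal to \<open>1\<close>.\<close>
  have sym: "norm (1 + (- t) *\<^sub>R u) = norm (1 + t *\<^sub>R u)" for t
  proof -
    have "qRe u = 0"
      using u by (simp add: quat_eq_iff) (smt (verit) mult_eq_0_iff zero_le_square)
    then show ?thesis by (simp add: norm_quat_def inner_quat_def)
  qed
  have "\<bar>?I\<bar> \<le> t * B" if t: "0 < t" "t \<le> 1" for t
  proof -
    have "2 * t * ?I = t * t * (?r (- t) - ?r t)"
      using expand[of t] expand[of "- t"] val[of t] val[of "- t"] sym[of t]
      by (simp add: power2_eq_square algebra_simps)
    then have "2 * ?I = t * (?r (- t) - ?r t)" using t by simp
    moreover have "\<bar>t * (?r (- t) - ?r t)\<bar> \<le> t * (2 * B)"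
      using bound_r[of t] bound_r[of "- t"] t by (simp add: abs_mult)
    ultimately show ?thesis by linarith
  qed
  then have "eventually (\<lambda>t. \<bar>?I\<bar> \<le> t * B) (at_right (0::real))"
    by (auto simp: eventually_at_right_field intro!: exI[of _ 1])
  moreover have "((\<lambda>t. t * B) \<longlongrightarrow> 0 * B) (at_right (0::real))"
    by (intro tendsto_intros)
  ultimately have "\<bar>?I\<bar> \<le> 0 * B"
    by (intro tendsto_lowerbound[of _ _ "at_right (0::real)"]) (simp_all add: trivial_limit_at_right_real)
  then show ?thesis by simp
qed

lemma integral_laplacian_sphere:
  assumes q: "real_polynomial_function q" "pos_homogeneous m q"
  shows "(LINT z|(sphere_measure :: quat measure). laplacian q z) = real m * (real m + 2) * (LINT z|sphere_measure. q z)"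
proof -
  have polyL: "real_polynomial_function (laplacian q)"
    unfolding laplacian_polynomial[OF q(1), abs_def]
    by (intro real_polynomial_function_sum polynomial_dir_deriv q) simp
  have int: "integrable sphere_measure f" if "real_polynomial_function f" for f :: "quat \<Rightarrow> real"
    by (intro integrable_sphere_measure continuous_on_polynomial that)
  have "0 = (\<Sum>u\<in>Basis - {1}. LINT z|sphere_measure. right_field u (right_field u q) z)"
    by (intro sum.neutral[symmetric] ballI integral_right_field[of _ m] polynomial_right_field
        pos_homogeneous_right_field q) (auto simp: quat_basis_squared)
  also have "\<dots> = (LINT z|sphere_measure. (\<Sum>u\<in>Basis - {1}. right_field u (right_field u q) z))"
    by (intro Bochner_Integration.integral_sum[symmetric] int polynomial_right_field q)
  also have "\<dots> = (LINT z|sphere_measure. (z \<bullet> z) * laplacian q z - real m * (real m + 2) * q z)"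
    by (simp only: casimir_right_field[OF q])
  also have "\<dots> = (LINT z|sphere_measure. laplacian q z - real m * (real m + 2) * q z)"
  proof (rule integral_cong_AE)
    show "AE z in (sphere_measure :: quat measure). (z \<bullet> z) * laplacian q z - real m * (real m + 2) * q z = laplacian q z - real m * (real m + 2) * q z"
      using AE_norm_sphere_measure by eventually_elim (simp add: dot_square_norm)
    have "continuous_on UNIV (laplacian q)" "continuous_on UNIV q"
      by (intro continuous_on_polynomial polyL q)+
    then show "(\<lambda>z. (z \<bullet> z) * laplacian q z - real m * (real m + 2) * q z) \<in> borel_measurable sphere_measure"
      "(\<lambda>z. laplacian q z - real m * (real m + 2) * q z) \<in> borel_measurable sphere_measure"
      by - (intro borel_measurable_integrable integrable_sphere_measure continuous_intros; assumption)+
  qed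
  also have "\<dots> = (LINT z|sphere_measure. laplacian q z) - real m * (real m + 2) * (LINT z|sphere_measure. q z)"
    using int[OF polyL] int[OF q(1)] by simp
  finally show ?thesis by simp
qed


section \<open>Moments of harmonic polynomials\<close>

lemma qRe_eq_inner: "qRe x = x \<bullet> 1"
  by (simp add: inner_quat_def)

lemma one_inner_quat: "1 \<bullet> b = qRe b"
  by (simp add: inner_quat_def)

lemma bounded_linear_qRe: "bounded_linear qRe"
  unfolding qRe_eq_inner[abs_def] by (rule bounded_linear_inner_left)

lemma polynomial_qRe: "real_polynomial_function qRe"
  by (rule real_polynomial_function.intros(1)[OF bounded_linear_qRe])

lemma polynomial_qRe_power: "real_polynomial_function (\<lambda>x. qRe x ^ j)"
  by (rule real_polynomial_function_power[OF polynomial_qRe])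

lemma integrable_sphere_polynomial:
  "real_polynomial_function f \<Longrightarrow> integrable sphere_measure (f :: 'a::euclidean_space \<Rightarrow> real)"
  by (intro integrable_sphere_measure continuous_on_polynomial)

lemma pos_homogeneous_mult:
  "pos_homogeneous k p \<Longrightarrow> pos_homogeneous m q \<Longrightarrow> pos_homogeneous (k + m) (\<lambda>x. p x * q x)"
  by (simp add: pos_homogeneous_def power_add)

lemma pos_homogeneous_qRe_power: "pos_homogeneous j (\<lambda>x. qRe x ^ j)"
  by (simp add: pos_homogeneous_def power_mult_distrib)

lemma laplacian_qRe_power: "laplacian (\<lambda>x. qRe x ^ j) x = real j * real (j - 1) * qRe x ^ (j - 2)"
proof -
  have d: "dir_deriv b (\<lambda>x. qRe x ^ i) = (\<lambda>x. real i * qRe b * qRe x ^ (i - 1))" for b i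
    by (rule ext) (simp add: dir_deriv_power[OF polynomial_qRe] dir_deriv_bounded_linear[OF bounded_linear_qRe])
  have "dir_deriv b (\<lambda>x. real j * qRe b * qRe x ^ (j - 1)) x
      = real j * real (j - 1) * qRe x ^ (j - 2) * (qRe b)\<^sup>2" for b
    by (subst dir_deriv_mult[OF real_polynomial_function.intros(2) polynomial_qRe_power])
       (simp add: d power2_eq_square mult_ac diff_diff_left numeral_2_eq_2)
  then have "laplacian (\<lambda>x. qRe x ^ j) x = real j * real (j - 1) * qRe x ^ (j - 2) * (\<Sum>b\<in>Basis. (qRe b)\<^sup>2)"
    unfolding laplacian_polynomial[OF polynomial_qRe_power] d by (simp add: sum_distrib_left)
  also have "(\<Sum>b\<in>Basis. (qRe b)\<^sup>2) = 1"
    by (simp add: Basis_quat_def)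
  finally show ?thesis by simp
qed

lemma laplacian_mult_qRe_power:
  assumes p: "real_polynomial_function p" and harm: "\<And>x. laplacian p x = 0"
  shows "laplacian (\<lambda>x. p x * qRe x ^ j) x =
    2 * real j * (dir_deriv 1 p x * qRe x ^ (j - 1)) + real j * real (j - 1) * (p x * qRe x ^ (j - 2))"
proof -
  have d: "dir_deriv b (\<lambda>x. qRe x ^ j) x = real j * qRe x ^ (j - 1) * (1 \<bullet> b)" for b
    by (simp add: dir_deriv_power[OF polynomial_qRe] dir_deriv_bounded_linear[OF bounded_linear_qRe]
        one_inner_quat)
  have "(\<Sum>b\<in>Basis. dir_deriv b p x * dir_deriv b (\<lambda>x. qRe x ^ j) x)
      = real j * qRe x ^ (j - 1) * dir_deriv 1 p x"
    by (subst dir_deriv_basis[OF p, of 1]) (simp add: d sum_distrib_left mult_ac)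
  then show ?thesis
    by (simp add: laplacian_mult[OF p polynomial_qRe_power] laplacian_qRe_power harm)
qed

text \<open>
  The mean value rule for the Laplacian, applied to \<open>p \<cdot> (Re x)\<^sup>j\<close>, lowers the power of \<open>Re x\<close>; in
  the first term on the right the harmonic factor is lowered to its derivative in direction \<open>1\<close>.
\<close>

lemma integral_harmonic_qRe_power_step:
  assumes p: "real_polynomial_function p" "pos_homogeneous k p" and harm: "\<And>x. laplacian p x = 0"
  shows "real (k + j) * (real (k + j) + 2) * (LINT z|sphere_measure. p z * qRe z ^ j) =
    2 * real j * (LINT z|sphere_measure. dir_deriv 1 p z * qRe z ^ (j - 1)) +
    real j * real (j - 1) * (LINT z|sphere_measure. p z * qRe z ^ (j - 2))"
proof -
  have int: "integrable sphere_measure (\<lambda>z. q z * qRe z ^ i)" if "real_polynomial_function q" for q i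
    by (intro integrable_sphere_polynomial real_polynomial_function.intros(4) that polynomial_qRe_power)
  have eq: "laplacian (\<lambda>x. p x * qRe x ^ j) = (\<lambda>x. 2 * real j * (dir_deriv 1 p x * qRe x ^ (j - 1))
      + real j * real (j - 1) * (p x * qRe x ^ (j - 2)))"
    by (rule ext) (rule laplacian_mult_qRe_power[OF p(1) harm])
  have "real (k + j) * (real (k + j) + 2) * (LINT z|sphere_measure. p z * qRe z ^ j) =
      (LINT z|sphere_measure. laplacian (\<lambda>x. p x * qRe x ^ j) z)"
    by (intro integral_laplacian_sphere[symmetric] real_polynomial_function.intros(4) p polynomial_qRe_power
        pos_homogeneous_mult pos_homogeneous_qRe_power)
  also have "\<dots> = 2 * real j * (LINT z|sphere_measure. dir_deriv 1 p z * qRe z ^ (j - 1)) +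
    real j * real (j - 1) * (LINT z|sphere_measure. p z * qRe z ^ (j - 2))"
    using int[OF p(1)] int[OF polynomial_dir_deriv[OF p(1), of 1]] unfolding eq by simp
  finally show ?thesis .
qed

lemma pos_homogeneous_0_const:
  fixes p :: "'a::real_normed_vector \<Rightarrow> real"
  assumes "continuous_on UNIV p" "pos_homogeneous 0 p"
  shows "p x = p 0"
proof -
  have "((\<lambda>c. p (c *\<^sub>R x)) \<longlongrightarrow> p (0 *\<^sub>R x)) (at_right (0::real))"
    by (intro continuous_on_tendsto_compose[OF assms(1)] tendsto_intros) auto
  moreover have "((\<lambda>c. p (c *\<^sub>R x)) \<longlongrightarrow> p x) (at_right (0::real))"
  proof (rule Lim_transform_eventually[OF tendsto_const])
    show "\<forall>\<^sub>F c in at_right (0::real). p x = p (c *\<^sub>R x)"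
      using assms(2) by (auto simp: pos_homogeneous_def eventually_at_right_field intro!: exI[of _ 1])
  qed
  ultimately show ?thesis
    using tendsto_unique[OF trivial_limit_at_right_real] by fastforce
qed

text \<open>
  In the recursion the second term has \<open>j - 2 < k\<close> and vanishes, and the first one preserves the
  difference \<open>k - j\<close>. For \<open>j < k\<close> it ends at the mean of a harmonic polynomial of positive degree, which
  is zero; for \<open>j = k\<close> it ends at a constant, and Euler's identity at the point \<open>1\<close> turns the
  derivative of \<open>p\<close> into \<open>k p(1)\<close> at each stage.
\<close>

lemma integral_harmonic_qRe_power:
  assumes "real_polynomial_function p" "pos_homogeneous k p" "\<And>x. laplacian p x = 0" "j \<le> k"
  shows "(LINT z|sphere_measure. p z * qRe z ^ j) = (if j = k then p 1 / (2 ^ k * (real k + 1)) else 0)"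
  using assms
proof (induction j arbitrary: p k rule: less_induct)
  case (less j)
  note p = less.prems(1-3)
  note step = integral_harmonic_qRe_power_step[OF p, of j]
  show ?case
  proof (cases "j = 0")
    case True
    show ?thesis
    proof (cases "k = 0")
      case k: True
      have "p = (\<lambda>x. p 0)"
        using pos_homogeneous_0_const[OF continuous_on_polynomial[OF p(1)] p(2)[unfolded k]] by blast
      then obtain c where "p = (\<lambda>x. c)" by blast
      then show ?thesis
        using True k by (simp add: measure_def emeasure_sphere_measure_UNIV)
    next
      case False
      then show ?thesis using step True by (simp add: add_eq_0_iff_both_eq_0)
    qed
  next
    case False
    then obtain k' where k: "k = Suc k'" using less.prems(4) by (cases k) auto
    have hom: "pos_homogeneous k' (dir_deriv 1 p)"
      using pos_homogeneous_dir_deriv p(1,2) k by blast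
    have 1: "(LINT z|sphere_measure. dir_deriv 1 p z * qRe z ^ (j - 1)) =
        (if j - 1 = k' then dir_deriv 1 p 1 / (2 ^ k' * (real k' + 1)) else 0)"
      using False less.prems(4) k
      by (intro less.IH hom polynomial_dir_deriv laplacian_dir_deriv p) auto
    have 2: "real j * real (j - 1) * (LINT z|sphere_measure. p z * qRe z ^ (j - 2)) = 0"
    proof (cases "j = 1")
      case True then show ?thesis by simp
    next
      case neq: False
      have "(LINT z|sphere_measure. p z * qRe z ^ (j - 2)) = (if j - 2 = k then p 1 / (2 ^ k * (real k + 1)) else 0)"
        using False less.prems(4) by (intro less.IH p) auto
      also have "\<dots> = 0" using False neq less.prems(4) by auto
      finally show ?thesis by simp
    qed
    have euler: "dir_deriv 1 p 1 = k * p 1"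
      by (rule euler_identity[OF p(1,2)])
    have pos: "real (k + j) * (real (k + j) + 2) > 0"
      using False by simp
    show ?thesis
    proof (cases "j = k")
      case True
      let ?I = "LINT z|sphere_measure. p z * qRe z ^ k"
      have k': "real k' + 1 = real k" "real k \<noteq> 0" "j - 1 = k'" using k True by simp_all
      have "(LINT z|sphere_measure. dir_deriv 1 p z * qRe z ^ (j - 1)) = p 1 / 2 ^ k'"
        using 1 k'(2) unfolding k'(3) k'(1) euler by simp
      with step have "(2 * real k) * ((2 * real k + 2) * ?I) = (2 * real k) * (p 1 / 2 ^ k')"
        unfolding 2 unfolding True by (simp only: of_nat_add mult_2[symmetric] of_nat_mult of_nat_numeral add_0_right mult.assoc)
      moreover have "2 * real k \<noteq> 0" using k by simp
      ultimately have "(2 * real k + 2) * ?I = p 1 / 2 ^ k'"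
        using mult_left_cancel by blast
      moreover have "2 * real k + 2 \<noteq> 0" by simp
      ultimately have "?I = p 1 / 2 ^ k' / (2 * real k + 2)"
        by (metis nonzero_mult_div_cancel_left)
      also have "\<dots> = p 1 / (2 ^ k * (real k + 1))"
        using k by (simp add: divide_simps)
      finally show ?thesis using True by simp
    next
      case neq: False
      then have "j - 1 \<noteq> k'" using k False by auto
      then have z: "(LINT z|sphere_measure. dir_deriv 1 p z * qRe z ^ (j - 1)) = 0"
        using 1 by simp
      have "real (k + j) * (real (k + j) + 2) * (LINT z|sphere_measure. p z * qRe z ^ j) = 0"
        using step unfolding z 2 by simp
      then show ?thesis
        using pos neq by (metis less_irrefl mult_eq_0_iff)
    qed
  qed
qed

section \<open>Zonal harmonics in dimension four\<close>

text \<open>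
  This is \<open>|x|\<^bsup>m-1\<^esup> U\<^bsub>m-1\<^esub>(Re x / |x|)\<close> with \<open>U\<close> the Chebyshev polynomials of the second kind. The index is
  shifted so that the value \<open>0\<close> at \<open>m = 0\<close> matches the convention for the zonal harmonic of degree
  \<open>-1\<close>, and so that \<open>Im (w\<^sup>m) = Im w\<close> times the value at \<open>m\<close>.
\<close>

fun spherical_chebyshev :: "nat \<Rightarrow> quat \<Rightarrow> real" where
  "spherical_chebyshev 0 x = 0"
| "spherical_chebyshev (Suc 0) x = 1"
| "spherical_chebyshev (Suc (Suc m)) x =
     2 * qRe x * spherical_chebyshev (Suc m) x - (x \<bullet> x) * spherical_chebyshev m x"

lemma polynomial_spherical_chebyshev: "real_polynomial_function (spherical_chebyshev m)"
proof (induction m rule: induct_nat_012)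
  case 0
  then show ?case by (simp add: real_polynomial_function.intros(2) fun_eq_iff[symmetric] spherical_chebyshev.simps(1)[abs_def])
next
  case 1
  then show ?case by (simp add: real_polynomial_function.intros(2) spherical_chebyshev.simps(2)[abs_def])
next
  case (ge2 m)
  then show ?case
    unfolding spherical_chebyshev.simps(3)[abs_def]
    by (intro real_polynomial_function_diff real_polynomial_function.intros(2,4) polynomial_qRe polynomial_inner_self)
qed

lemma spherical_chebyshev_scaleR:
  "spherical_chebyshev (Suc m) (c *\<^sub>R x) = c ^ m * spherical_chebyshev (Suc m) x"
proof (induction m rule: induct_nat_012)
  case (ge2 m)
  show ?case
    unfolding spherical_chebyshev.simps(3)[of "Suc m"] ge2 by (simp add: algebra_simps)
qed simp_all

lemma pos_homogeneous_spherical_chebyshev: "pos_homogeneous m (spherical_chebyshev (Suc m))"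
  unfolding pos_homogeneous_def by (simp add: spherical_chebyshev_scaleR)

lemma dir_deriv_spherical_chebyshev_Suc_Suc:
  "dir_deriv v (spherical_chebyshev (Suc (Suc m))) x =
    2 * qRe v * spherical_chebyshev (Suc m) x + 2 * qRe x * dir_deriv v (spherical_chebyshev (Suc m)) x
    - (2 * (x \<bullet> v) * spherical_chebyshev m x + (x \<bullet> x) * dir_deriv v (spherical_chebyshev m) x)"
proof -
  note p = polynomial_spherical_chebyshev
  have p2: "real_polynomial_function (\<lambda>x. 2 * qRe x)"
    by (intro real_polynomial_function.intros(2,4) polynomial_qRe)
  have "bounded_linear (\<lambda>x. 2 * qRe x)"
    by (intro bounded_linear_const_mult bounded_linear_qRe)
  then have d: "dir_deriv v (\<lambda>x. 2 * qRe x) x = 2 * qRe v"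
    by (rule dir_deriv_bounded_linear)
  show ?thesis
    unfolding spherical_chebyshev.simps(3)[abs_def]
      dir_deriv_diff[OF real_polynomial_function.intros(4)[OF p2 p] real_polynomial_function.intros(4)[OF polynomial_inner_self p]]
      dir_deriv_mult[OF p2 p] dir_deriv_mult[OF polynomial_inner_self p] dir_deriv_inner_self d ..
qed

text \<open>
  The derivative is the next lower member of the family up to a factor. This is the relation that
  makes the first-order terms of the Laplacian cancel.
\<close>

lemma dir_deriv_one_spherical_chebyshev:
  "dir_deriv 1 (spherical_chebyshev (Suc m)) x = real (Suc m) * spherical_chebyshev m x"
proof (induction m arbitrary: x rule: less_induct)
  case (less m)
  show ?case
  proof (cases m)
    case 0
    then show ?thesis by (simp add: spherical_chebyshev.simps(2)[abs_def])
  next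
    case (Suc m')
    have IH: "dir_deriv 1 (spherical_chebyshev (Suc m')) x = real (Suc m') * spherical_chebyshev m' x"
      using less[of m'] Suc by simp
    show ?thesis
    proof (cases m')
      case 0
      then show ?thesis
        using IH unfolding Suc dir_deriv_spherical_chebyshev_Suc_Suc
        by (simp add: spherical_chebyshev.simps(1)[abs_def])
    next
      case (Suc m'')
      have IH': "dir_deriv 1 (spherical_chebyshev m') x = real m' * spherical_chebyshev m'' x"
        using less[of m''] \<open>m = Suc m'\<close> Suc by simp
      have "x \<bullet> 1 = qRe x" by (simp add: qRe_eq_inner)
      then show ?thesis
        unfolding \<open>m = Suc m'\<close> dir_deriv_spherical_chebyshev_Suc_Suc IH IH'
        using spherical_chebyshev.simps(3)[of m'' x] Suc
        by (simp add: algebra_simps)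
    qed
  qed
qed

lemma laplacian_twice_qRe_mult:
  assumes p: "real_polynomial_function p"
  shows "laplacian (\<lambda>x. 2 * qRe x * p x) x = 4 * dir_deriv 1 p x + 2 * qRe x * laplacian p x"
proof -
  have p2: "real_polynomial_function (\<lambda>x. 2 * qRe x)"
    by (intro real_polynomial_function.intros(2,4) polynomial_qRe)
  have "bounded_linear (\<lambda>x. 2 * qRe x)"
    by (intro bounded_linear_const_mult bounded_linear_qRe)
  then have d: "dir_deriv b (\<lambda>x. 2 * qRe x) = (\<lambda>x. 2 * (1 \<bullet> b))" for b
    by (auto simp: dir_deriv_bounded_linear qRe_eq_inner inner_commute)
  have "laplacian (\<lambda>x. 2 * qRe x) x = 0"
    by (simp add: laplacian_polynomial[OF p2] d)
  moreover have "(\<Sum>b\<in>Basis. dir_deriv b (\<lambda>x. 2 * qRe x) x * dir_deriv b p x) = 2 * dir_deriv 1 p x"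
    unfolding d by (subst dir_deriv_basis[OF p, of 1]) (simp add: sum_distrib_left mult_ac)
  ultimately show ?thesis
    by (simp add: laplacian_mult[OF p2 p])
qed

lemma laplacian_inner_self_mult:
  assumes p: "real_polynomial_function p"
  shows "laplacian (\<lambda>x. (x \<bullet> x) * p x) (x::quat) = 8 * p x + 4 * dir_deriv x p x + (x \<bullet> x) * laplacian p x"
proof -
  have d: "dir_deriv b (\<lambda>x::quat. x \<bullet> x) = (\<lambda>x. 2 * (x \<bullet> b))" for b
    by (rule ext) (rule dir_deriv_inner_self)
  have "dir_deriv b (\<lambda>x::quat. 2 * (x \<bullet> b)) x = 2 * (b \<bullet> b)" for b
    by (subst dir_deriv_bounded_linear) (auto intro: bounded_linear_const_mult bounded_linear_inner_left)
  then have "laplacian (\<lambda>x::quat. x \<bullet> x) x = (\<Sum>b\<in>(Basis::quat set). 2)"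
    unfolding laplacian_polynomial[OF polynomial_inner_self] d by (intro sum.cong) simp_all
  also have "\<dots> = 8" by (simp add: Basis_quat_def)
  finally have "laplacian (\<lambda>x::quat. x \<bullet> x) x = 8" .
  moreover have "(\<Sum>b\<in>Basis. dir_deriv b (\<lambda>x. x \<bullet> x) x * dir_deriv b p x) = 2 * dir_deriv x p x"
    by (subst dir_deriv_basis[OF p, of x]) (simp add: d sum_distrib_left mult_ac)
  ultimately show ?thesis
    by (simp add: laplacian_mult[OF polynomial_inner_self p])
qed

lemma laplacian_const: "laplacian (\<lambda>x. c) x = 0"
  by (simp add: laplacian_def numeral_2_eq_2)

lemma laplacian_diff:
  assumes f: "real_polynomial_function f" and g: "real_polynomial_function g"
  shows "laplacian (\<lambda>x. f x - g x) x = laplacian f x - laplacian g x"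
  using laplacian_add[OF real_polynomial_function_diff[OF f g] g, of x] by simp

text \<open>
  In the Laplacian of the recursion, the factor \<open>2 Re x\<close> contributes four times the derivative in
  direction \<open>1\<close> of the function of index \<open>m + 1\<close>, and the factor \<open>|x|\<^sup>2\<close> contributes \<open>8 + 4 E\<close> applied
  to the function of index \<open>m\<close>, which has degree \<open>m - 1\<close>. Both are \<open>4 (m + 1)\<close> times the latter
  function, and they cancel.
\<close>

lemma laplacian_spherical_chebyshev: "laplacian (spherical_chebyshev m) x = 0"
proof (induction m arbitrary: x rule: less_induct)
  case (less m)
  note p = polynomial_spherical_chebyshev
  consider "m = 0" | "m = 1" | m' where "m = Suc (Suc m')"
    by (metis One_nat_def not0_implies_Suc)
  then show ?case
  proof cases
    case 1
    then show ?thesis by (simp add: laplacian_const spherical_chebyshev.simps(1)[abs_def])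
  next
    case 2
    then show ?thesis by (simp add: laplacian_const spherical_chebyshev.simps(2)[abs_def])
  next
    case 3
    have p1: "real_polynomial_function (\<lambda>x. 2 * qRe x * spherical_chebyshev (Suc m') x)"
      and p2: "real_polynomial_function (\<lambda>x. (x \<bullet> x) * spherical_chebyshev m' x)"
      by (intro real_polynomial_function.intros(2,4) polynomial_qRe polynomial_inner_self p)+
    have euler: "8 * spherical_chebyshev m' x + 4 * dir_deriv x (spherical_chebyshev m') x
        = 4 * real (Suc m') * spherical_chebyshev m' x"
    proof (cases m')
      case 0
      then show ?thesis by (simp add: spherical_chebyshev.simps(1)[abs_def])
    next
      case (Suc k)
      show ?thesis
        unfolding Suc euler_identity[OF p pos_homogeneous_spherical_chebyshev] by (simp add: algebra_simps)
    qed
    show ?thesis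
      unfolding 3 spherical_chebyshev.simps(3)[abs_def] laplacian_diff[OF p1 p2]
        laplacian_twice_qRe_mult[OF p] laplacian_inner_self_mult[OF p] dir_deriv_one_spherical_chebyshev
      using less[of m' x] less[of "Suc m'" x] 3 euler by simp
  qed
qed

text \<open>
  Restricted to the sphere, the recursion expresses each function through \<open>Re x\<close> times its predecessor
  and a term of lower degree, and the latter is orthogonal to \<open>p\<close>. Only the leading coefficient
  \<open>2\<^sup>i\<close> survives.
\<close>

lemma integral_harmonic_spherical_chebyshev:
  assumes p: "real_polynomial_function p" "pos_homogeneous k p" "\<And>x. laplacian p x = 0"
    and "i + j \<le> k"
  shows "(LINT z|sphere_measure. p z * qRe z ^ j * spherical_chebyshev (Suc i) z)
    = 2 ^ i * (LINT z|sphere_measure. p z * qRe z ^ (i + j))"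
  using assms(4)
proof (induction i arbitrary: j rule: less_induct)
  case (less i)
  consider "i = 0" | "i = 1" | i' where "i = Suc (Suc i')"
    by (metis One_nat_def not0_implies_Suc)
  then show ?case
  proof cases
    case 1 then show ?thesis by simp
  next
    case 2
    then show ?thesis by (simp add: mult_ac flip: Bochner_Integration.integral_mult_right_zero)
  next
    case 3
    have poly: "real_polynomial_function (\<lambda>z. p z * qRe z ^ j' * spherical_chebyshev i z)" for j' i
      by (intro real_polynomial_function.intros(4) p polynomial_qRe_power polynomial_spherical_chebyshev)
    have "(LINT z|sphere_measure. p z * qRe z ^ j * spherical_chebyshev (Suc i) z) =
        (LINT z|sphere_measure. 2 * (p z * qRe z ^ Suc j * spherical_chebyshev (Suc (Suc i')) z)
            - p z * qRe z ^ j * spherical_chebyshev (Suc i') z)"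
    proof (rule integral_cong_AE)
      show "AE z in sphere_measure. p z * qRe z ^ j * spherical_chebyshev (Suc i) z =
          2 * (p z * qRe z ^ Suc j * spherical_chebyshev (Suc (Suc i')) z) - p z * qRe z ^ j * spherical_chebyshev (Suc i') z"
        using AE_norm_sphere_measure
      proof eventually_elim
        case (elim z)
        then have "z \<bullet> z = 1" by (simp add: dot_square_norm)
        then show ?case unfolding 3 spherical_chebyshev.simps(3)[of "Suc i'"] by (simp add: algebra_simps)
      qed
    qed (intro borel_measurable_integrable integrable_sphere_polynomial poly real_polynomial_function_diff
          real_polynomial_function.intros(4)[OF real_polynomial_function.intros(2)])+
    also have "\<dots> = 2 * (LINT z|sphere_measure. p z * qRe z ^ Suc j * spherical_chebyshev (Suc (Suc i')) z)
        - (LINT z|sphere_measure. p z * qRe z ^ j * spherical_chebyshev (Suc i') z)"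
      using integrable_sphere_polynomial[OF poly[of "Suc j" "Suc (Suc i')"]] integrable_sphere_polynomial[OF poly[of j "Suc i'"]]
      by (simp del: power_Suc)
    also have "(LINT z|sphere_measure. p z * qRe z ^ Suc j * spherical_chebyshev (Suc (Suc i')) z)
        = 2 ^ Suc i' * (LINT z|sphere_measure. p z * qRe z ^ (Suc i' + Suc j))"
      using less.prems 3 by (intro less.IH) auto
    also have "(LINT z|sphere_measure. p z * qRe z ^ j * spherical_chebyshev (Suc i') z)
        = 2 ^ i' * (LINT z|sphere_measure. p z * qRe z ^ (i' + j))"
      using less.prems 3 by (intro less.IH) auto
    also have "(LINT z|sphere_measure. p z * qRe z ^ (i' + j)) = 0"
      using less.prems 3 integral_harmonic_qRe_power[OF p, of "i' + j"] by simp
    finally show ?thesis using 3 by simp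
  qed
qed

lemma spherical_chebyshev_reproducing:
  assumes p: "real_polynomial_function p" "pos_homogeneous k p" "\<And>x. laplacian p x = 0"
  shows "(LINT z|sphere_measure. p z * spherical_chebyshev (Suc k) z) = p 1 / (real k + 1)"
proof -
  have cancel: "2 ^ k * (p 1 / (2 ^ k * c)) = p 1 / c" for c :: real
    by simp
  have "(LINT z|sphere_measure. p z * spherical_chebyshev (Suc k) z) = 2 ^ k * (LINT z|sphere_measure. p z * qRe z ^ k)"
    using integral_harmonic_spherical_chebyshev[OF p, of k 0] by simp
  also have "(LINT z|sphere_measure. p z * qRe z ^ k) = p 1 / (2 ^ k * (real k + 1))"
    using integral_harmonic_qRe_power[OF p, of k] by simp
  finally show ?thesis unfolding cancel .
qed

lemma homogeneous_harmonicD: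
  assumes "homogeneous_harmonic k p"
  shows "real_polynomial_function p" "pos_homogeneous k p" "laplacian p x = 0"
  using assms by (simp_all add: homogeneous_harmonic_def pos_homogeneous_def)

lemma homogeneous_harmonic_diff:
  assumes "homogeneous_harmonic k p" "homogeneous_harmonic k q"
  shows "homogeneous_harmonic k (\<lambda>x. p x - q x)"
  using assms by (auto simp: homogeneous_harmonic_def laplacian_diff right_diff_distrib)

lemma homogeneous_harmonic_spherical_chebyshev:
  "homogeneous_harmonic k (\<lambda>x. real (k + 1) * spherical_chebyshev (Suc k) x)"
proof -
  have poly: "real_polynomial_function (\<lambda>x. real (k + 1) * spherical_chebyshev (Suc k) x)"
    by (intro real_polynomial_function.intros(2,4) polynomial_spherical_chebyshev)
  have "laplacian (\<lambda>x. real (k + 1) * spherical_chebyshev (Suc k) x) x = 0" for x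
    by (simp add: laplacian_mult[OF real_polynomial_function.intros(2) polynomial_spherical_chebyshev]
        laplacian_spherical_chebyshev laplacian_const del: of_nat_add of_nat_Suc)
  then show ?thesis
    using poly unfolding homogeneous_harmonic_def
    by (simp add: spherical_chebyshev_scaleR mult_ac del: spherical_chebyshev.simps)
qed

text \<open>
  A vanishing mean square makes \<open>p\<close> zero at almost all directions, hence by homogeneity almost
  everywhere in the ball, hence everywhere by continuity.
\<close>

lemma homogeneous_harmonic_eq_0_if_L2_zero:
  fixes p :: "'a::euclidean_space \<Rightarrow> real"
  assumes p: "homogeneous_harmonic k p" and int: "(LINT z|sphere_measure. p z * p z) = 0"
  shows "p x = 0"
proof (rule ccontr)
  assume "p x \<noteq> 0"
  have cont: "continuous_on UNIV p"
    by (rule continuous_on_polynomial[OF homogeneous_harmonicD(1)[OF p]])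
  have hom: "p (c *\<^sub>R y) = c ^ k * p y" for c y
    using p by (simp add: homogeneous_harmonic_def)
  \<comment> \<open>A point of the open ball on the ray of \<open>x\<close>, also for \<open>x = 0\<close>.\<close>
  define y where "y = x /\<^sub>R (norm x + 1)"
  have y: "p y \<noteq> 0" "norm y < 1"
    using \<open>p x \<noteq> 0\<close> by (simp_all add: y_def hom add_nonneg_eq_0_iff divide_simps)
      (use norm_ge_zero[of x] in linarith)+
  have meas [measurable]: "p \<in> borel_measurable borel" by (rule borel_measurable_continuous_onI[OF cont])
  have "AE z in sphere_measure. p z * p z = 0"
    using int by (subst (asm) integral_nonneg_eq_0_iff_AE)
      (auto intro!: integrable_sphere_measure continuous_intros cont)
  then have "AE z in sphere_measure. p z = 0" by simp
  then have "AE z in lborel. z \<in> ball 0 1 \<longrightarrow> p (sgn z) = 0"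
    by (subst (asm) AE_sphere_measure_iff) simp_all
  then have AE: "AE z in lborel. z \<notin> ball 0 1 \<inter> p -` (- {0})"
  proof eventually_elim
    case (elim z)
    have "z = norm z *\<^sub>R sgn z" by (cases "z = 0") (simp_all add: sgn_div_norm)
    then have "p z = norm z ^ k * p (sgn z)" using hom by metis
    with elim show ?case by auto
  qed
  have opn: "open (ball 0 1 \<inter> p -` (- {0}))"
    by (intro open_Int open_ball open_vimage cont) auto
  have "ball 0 1 \<inter> p -` (- {0}) \<in> null_sets lborel"
    using AE opn by (subst AE_iff_null_sets) auto
  then have "negligible (ball 0 1 \<inter> p -` (- {0}))"
    by (simp add: negligible_iff_null_sets null_sets_completionI)
  then have "ball 0 1 \<inter> p -` (- {0}) = {}"
    using open_not_negligible[OF opn] by blast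
  then show False using y by auto
qed

lemma zonal_harmonic_quat: "zonal_harmonic k x 1 = real (k + 1) * spherical_chebyshev (Suc k) x"
proof -
  let ?Z = "\<lambda>x. real (k + 1) * spherical_chebyshev (Suc k) x"
  let ?R = "\<lambda>Z::quat \<Rightarrow> real. homogeneous_harmonic k Z \<and>
     (\<forall>p. homogeneous_harmonic k p \<longrightarrow> p 1 = (LINT \<zeta>|sphere_measure. p \<zeta> * Z \<zeta>))"
  have Z: "?R ?Z"
  proof (intro conjI allI impI)
    show "homogeneous_harmonic k ?Z" by (rule homogeneous_harmonic_spherical_chebyshev)
    fix p :: "quat \<Rightarrow> real" assume p: "homogeneous_harmonic k p"
    have "(LINT \<zeta>|sphere_measure. p \<zeta> * ?Z \<zeta>) = (LINT \<zeta>|sphere_measure. real (k + 1) * (p \<zeta> * spherical_chebyshev (Suc k) \<zeta>))"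
      by (simp only: mult_ac)
    also have "\<dots> = real (k + 1) * (LINT \<zeta>|sphere_measure. p \<zeta> * spherical_chebyshev (Suc k) \<zeta>)"
      by (rule integral_mult_right_zero)
    also have "\<dots> = p 1"
    proof -
      have cancel: "(real k + 1) * (p 1 / (real k + 1)) = p 1" by (simp only: times_divide_eq_right) (rule nonzero_mult_div_cancel_left, simp)
      show ?thesis
        unfolding spherical_chebyshev_reproducing[OF homogeneous_harmonicD[OF p]] of_nat_add of_nat_1 by (rule cancel)
    qed
    finally show "p 1 = (LINT \<zeta>|sphere_measure. p \<zeta> * ?Z \<zeta>)" ..
  qed
  have "Z = ?Z" if R: "?R Z" for Z
  proof
    fix y
    let ?D = "\<lambda>x. Z x - ?Z x"
    have D: "homogeneous_harmonic k ?D"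
      using R Z by (intro homogeneous_harmonic_diff) blast+
    have poly: "real_polynomial_function ?D" "real_polynomial_function Z" "real_polynomial_function ?Z"
      using D R Z homogeneous_harmonicD(1) by blast+
    have sq: "?D z * ?D z = ?D z * Z z - ?D z * ?Z z" for z
      by (rule right_diff_distrib)
    have "(LINT \<zeta>|sphere_measure. ?D \<zeta> * ?D \<zeta>) =
        (LINT \<zeta>|sphere_measure. ?D \<zeta> * Z \<zeta>) - (LINT \<zeta>|sphere_measure. ?D \<zeta> * ?Z \<zeta>)"
      unfolding sq
      by (intro Bochner_Integration.integral_diff integrable_sphere_polynomial real_polynomial_function.intros(4) poly)
    also have "\<dots> = ?D 1 - ?D 1"
      using conjunct2[OF R, rule_format, OF D] conjunct2[OF Z, rule_format, OF D] by (simp only:)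
    finally have "?D y = 0"
      by (intro homogeneous_harmonic_eq_0_if_L2_zero[OF D]) simp
    then show "Z y = ?Z y" by simp
  qed
  with Z have "(THE Z. ?R Z) = ?Z" by (intro the_equality)
  then show ?thesis unfolding zonal_harmonic_def by (rule fun_cong)
qed

lemma zonal_tilde_eq: "zonal_tilde (int m - 1) x = spherical_chebyshev m x"
proof (cases m)
  case 0
  then show ?thesis by (simp add: zonal_tilde_def)
next
  case (Suc k)
  then show ?thesis by (simp add: zonal_tilde_def zonal_harmonic_quat field_simps del: spherical_chebyshev.simps)
qed


section \<open>Ordered products\<close>

lemma oprod_empty [simp]: "oprod {} q = 1"
  by (simp add: oprod_def)

lemma oprod_insert_less:
  assumes "finite A" "\<forall>a\<in>A. b < a"
  shows "oprod (insert b A) q = q b * oprod A q"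
proof -
  have "b \<notin> A" using assms by auto
  then have "sorted_list_of_set (insert b A) = b # sorted_list_of_set A"
    using assms by (subst sorted_list_of_set_insert) (auto intro!: insort_is_Cons less_imp_le)
  then show ?thesis by (simp add: oprod_def)
qed

lemma oprod_cong:
  assumes "\<And>k. k \<in> A \<Longrightarrow> q k = r k"
  shows "oprod A q = oprod A r"
proof (cases "finite A")
  case True
  then show ?thesis using assms by (auto simp: oprod_def intro!: arg_cong[of _ _ prod_list])
qed (simp add: oprod_def)

lemma oprod_scaleR:
  fixes q :: "'i::linorder \<Rightarrow> 'a::real_algebra_1"
  assumes "finite A"
  shows "oprod A (\<lambda>k. r k *\<^sub>R q k) = (\<Prod>k\<in>A. r k) *\<^sub>R oprod A q"
  using assms
proof (induction rule: finite_linorder_min_induct)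
  case (insert b A)
  then have "b \<notin> A" by auto
  with insert show ?case by (simp add: oprod_insert_less)
qed simp

lemma oprod_neq_0:
  fixes q :: "'i::linorder \<Rightarrow> 'a::ring_1_no_zero_divisors"
  assumes "finite A" "\<And>k. k \<in> A \<Longrightarrow> q k \<noteq> 0"
  shows "oprod A q \<noteq> 0"
  using assms
proof (induction rule: finite_linorder_min_induct)
  case (insert b A)
  then show ?case by (simp add: oprod_insert_less)
qed simp

lemma oprod_extend_by_one:
  assumes "finite A" "K \<subseteq> A"
  shows "oprod A (\<lambda>i. if i \<in> K then q i else 1) = oprod K q"
  using assms
proof (induction arbitrary: K rule: finite_linorder_min_induct)
  case (insert b A)
  have b: "b \<notin> A" using insert.hyps by auto
  show ?case
  proof (cases "b \<in> K")
    case True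
    let ?K = "K - {b}"
    have K: "?K \<subseteq> A" "finite ?K" using insert.prems insert.hyps finite_subset by auto
    have "oprod A (\<lambda>i. if i \<in> K then q i else 1) = oprod A (\<lambda>i. if i \<in> ?K then q i else 1)"
      using b by (intro oprod_cong) auto
    also have "\<dots> = oprod ?K q" by (rule insert.IH[OF K(1)])
    finally have "oprod (insert b A) (\<lambda>i. if i \<in> K then q i else 1) = q b * oprod ?K q"
      using insert.hyps True by (simp add: oprod_insert_less)
    also have "\<dots> = oprod (insert b ?K) q"
      using K insert.hyps by (subst oprod_insert_less) auto
    also have "insert b ?K = K" using True by auto
    finally show ?thesis .
  next
    case False
    then have "K \<subseteq> A" using insert.prems by auto
    then show ?thesis using insert False by (simp add: oprod_insert_less)
  qed
qed simp

text \<open>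
  Distributivity for ordered products: the real coefficients commute with everything, so choosing the
  factors \<open>q i\<close> for \<open>i \<in> K\<close> leaves them in their increasing order.
\<close>

lemma oprod_add_expand:
  fixes q :: "'i::linorder \<Rightarrow> 'a::real_algebra_1"
  assumes "finite A"
  shows "oprod A (\<lambda>i. r i *\<^sub>R 1 + s i *\<^sub>R q i) =
    (\<Sum>K\<in>Pow A. (\<Prod>i\<in>A. if i \<in> K then s i else r i) *\<^sub>R oprod K q)"
  using assms
proof (induction rule: finite_linorder_min_induct)
  case (insert b A)
  have b: "b \<notin> A" using insert.hyps by auto
  have inj: "inj_on (insert b) (Pow A)" using b by (auto simp: inj_on_def)
  have disj: "Pow A \<inter> insert b ` Pow A = {}" using b by auto
  have prod: "(\<Prod>i\<in>insert b A. if i \<in> K then s i else r i) = r b * (\<Prod>i\<in>A. if i \<in> K then s i else r i)"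
    "(\<Prod>i\<in>insert b A. if i \<in> insert b K then s i else r i) = s b * (\<Prod>i\<in>A. if i \<in> K then s i else r i)"
    "oprod (insert b K) q = q b * oprod K q" if "K \<in> Pow A" for K
  proof -
    have "b \<notin> K" "finite K" "\<forall>a\<in>K. b < a" using that b insert.hyps finite_subset by auto
    moreover have "(\<Prod>i\<in>A. if i = b \<or> i \<in> K then s i else r i) = (\<Prod>i\<in>A. if i \<in> K then s i else r i)"
      using b by (intro prod.cong) auto
    ultimately show "(\<Prod>i\<in>insert b A. if i \<in> K then s i else r i) = r b * (\<Prod>i\<in>A. if i \<in> K then s i else r i)"
      "(\<Prod>i\<in>insert b A. if i \<in> insert b K then s i else r i) = s b * (\<Prod>i\<in>A. if i \<in> K then s i else r i)"
      "oprod (insert b K) q = q b * oprod K q"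
      using insert.hyps b by (simp_all add: oprod_insert_less)
  qed
  have "(\<Sum>K\<in>Pow (insert b A). (\<Prod>i\<in>insert b A. if i \<in> K then s i else r i) *\<^sub>R oprod K q) =
      (\<Sum>K\<in>Pow A. (\<Prod>i\<in>insert b A. if i \<in> K then s i else r i) *\<^sub>R oprod K q) +
      (\<Sum>K\<in>Pow A. (\<Prod>i\<in>insert b A. if i \<in> insert b K then s i else r i) *\<^sub>R oprod (insert b K) q)"
    unfolding Pow_insert using insert.hyps disj inj by (subst sum.union_disjoint) (auto simp: sum.reindex)
  also have "\<dots> = (r b *\<^sub>R 1 + s b *\<^sub>R q b) * (\<Sum>K\<in>Pow A. (\<Prod>i\<in>A. if i \<in> K then s i else r i) *\<^sub>R oprod K q)"
    unfolding distrib_right sum_distrib_left sum.distrib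
    by (intro arg_cong2[of _ _ _ _ "(+)"] sum.cong refl) (simp_all only: prod mult_scaleR_left mult_scaleR_right scaleR_scaleR mult_1_left mult.commute)
  finally show ?case
    using insert by (simp only: oprod_insert_less)
qed simp

section \<open>Sums over subsets\<close>

text \<open>
  A sum over all subsets is a product over all indices as soon as its summand is a product of local
  factors. Signs of the form \<open>(-1)\<^bsup>|A|\<^esup>\<close> have this shape, so the identities for stem functions reduce
  to identities for a single index.
\<close>

lemma sum_subsets_prod:
  fixes g h :: "'n::finite \<Rightarrow> 'a::comm_semiring_1"
  shows "(\<Sum>A\<in>UNIV. \<Prod>i\<in>UNIV. if i \<in> A then g i else h i) = (\<Prod>i\<in>UNIV. g i + h i)"
  by (subst prod_add) (simp_all add: prod.If_cases flip: Compl_eq_Diff_UNIV)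

lemma sign_card_eq_prod:
  "(-1) ^ card (A :: 'n::finite set) = (\<Prod>i\<in>UNIV. if i \<in> A then -1 else (1::'a::comm_ring_1))"
  by (simp add: prod.If_cases)

lemma subset_characters_orthogonal:
  fixes K L :: "'n::finite set"
  shows "(\<Sum>A\<in>UNIV. (-1) ^ card (K \<inter> A) * (-1) ^ card (L \<inter> A)) = (if K = L then 2 ^ CARD('n) else (0::real))"
proof -
  have "(-1) ^ card (K \<inter> A) * (-1) ^ card (L \<inter> A) =
      (\<Prod>i\<in>UNIV. if i \<in> A then (if i \<in> K \<longleftrightarrow> i \<in> L then 1 else -1) else (1::real))" for A
    unfolding sign_card_eq_prod prod.distrib[symmetric] by (intro prod.cong) auto
  then have "(\<Sum>A\<in>UNIV. (-1) ^ card (K \<inter> A) * (-1) ^ card (L \<inter> A)) =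
      (\<Prod>i\<in>UNIV. (if i \<in> K \<longleftrightarrow> i \<in> L then 1 else -1) + (1::real))"
    by (simp only: sum_subsets_prod)
  also have "\<dots> = (if K = L then 2 ^ CARD('n) else 0)"
  proof (cases "K = L")
    case False
    then obtain i where "\<not> (i \<in> K \<longleftrightarrow> i \<in> L)" by blast
    then have "(\<Prod>i\<in>UNIV. (if i \<in> K \<longleftrightarrow> i \<in> L then 1 else -1) + (1::real)) = 0"
      by (intro prod_zero) auto
    then show ?thesis using False by simp
  qed simp
  finally show ?thesis .
qed

section \<open>Slice functions and their stem functions\<close>

lemma imag_units_iff: "J \<in> imag_units \<longleftrightarrow> qRe J = 0 \<and> norm J = 1"
proof
  assume J: "J \<in> imag_units"
  then have sq: "J * J = -1" by (simp add: imag_units_def power2_eq_square)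
  then have "norm J * norm J = 1" by (metis norm_mult norm_minus_cancel norm_one)
  then have "norm J = 1" by (metis norm_ge_zero power2_eq_square power2_eq_1_iff le_minus_one_simps(3))
  moreover have "qRe J = 0"
    using sq by (simp add: quat_eq_iff) (smt (verit) mult_eq_0_iff zero_le_square)
  ultimately show "qRe J = 0 \<and> norm J = 1" by simp
next
  assume J: "qRe J = 0 \<and> norm J = 1"
  then have "J \<bullet> J = 1" by (simp add: norm_eq_1)
  with J show "J \<in> imag_units"
    by (simp add: imag_units_def power2_eq_square quat_eq_iff inner_quat_def)
qed

lemma uminus_imag_units: "J \<in> imag_units \<Longrightarrow> - J \<in> imag_units"
  by (simp add: imag_units_def)

lemma imag_units_neq_0: "J \<in> imag_units \<Longrightarrow> J \<noteq> 0"
  by (auto simp: imag_units_iff)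

lemma ex_imag_unit: "\<exists>J. J \<in> imag_units"
  by (rule exI[of _ "Quat 0 1 0 0"]) (simp add: imag_units_def power2_eq_square quat_eq_iff)

text \<open>
  For an imaginary unit \<open>J\<close> this is the algebra embedding of \<open>\<complex>\<close> onto the slice spanned by \<open>1\<close> and \<open>J\<close>.
\<close>

definition complex_to_quat :: "quat \<Rightarrow> complex \<Rightarrow> quat" where
  "complex_to_quat J w = Re w *\<^sub>R 1 + Im w *\<^sub>R J"

lemma slice_point_nth: "slice_point J z $ i = complex_to_quat (J $ i) (z $ i)"
  by (simp add: slice_point_def complex_to_quat_def of_real_def)

lemma complex_to_quat_mult:
  assumes "J \<in> imag_units"
  shows "complex_to_quat J (v * w) = complex_to_quat J v * complex_to_quat J w"
proof -
  have "J * J = -1" using assms by (simp add: imag_units_def power2_eq_square)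
  then show ?thesis by (simp add: complex_to_quat_def algebra_simps)
qed

lemma complex_to_quat_power:
  assumes "J \<in> imag_units"
  shows "complex_to_quat J (w ^ m) = complex_to_quat J w ^ m"
  by (induction m) (simp_all add: complex_to_quat_mult assms, simp add: complex_to_quat_def)

lemma ex_complex_to_quat: "\<exists>J w. J \<in> imag_units \<and> x = complex_to_quat J w"
proof -
  define v where "v = x - qRe x *\<^sub>R 1"
  have v: "qRe v = 0" by (simp add: v_def)
  have x: "x = qRe x *\<^sub>R 1 + v" by (simp add: v_def)
  show ?thesis
  proof (cases "v = 0")
    case True
    obtain J where "J \<in> imag_units" using ex_imag_unit by blast
    then show ?thesis using x True
      by (intro exI[of _ J] exI[of _ "Complex (qRe x) 0"]) (simp add: complex_to_quat_def)
  next
    case False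
    then have "v /\<^sub>R norm v \<in> imag_units" using v by (simp add: imag_units_iff)
    then show ?thesis using x False
      by (intro exI[of _ "v /\<^sub>R norm v"] exI[of _ "Complex (qRe x) (norm v)"]) (simp add: complex_to_quat_def)
  qed
qed

lemma ex_slice_point: "\<exists>J z. (\<forall>h. J $ h \<in> imag_units) \<and> x = slice_point J z"
proof -
  have "\<forall>h. \<exists>J w. J \<in> imag_units \<and> x $ h = complex_to_quat J w"
    using ex_complex_to_quat by blast
  then obtain J w where "\<And>h. J h \<in> imag_units \<and> x $ h = complex_to_quat (J h) (w h)" by metis
  then show ?thesis
    by (intro exI[of _ "\<chi> h. J h"] exI[of _ "\<chi> h. w h"]) (simp add: vec_eq_iff slice_point_nth)
qed

lemma complex_to_quat_eq_iff:
  assumes J: "J \<in> imag_units" "J' \<in> imag_units" and eq: "complex_to_quat J w = complex_to_quat J' w'"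
  shows "(w' = w \<or> w' = cnj w) \<and> (Im w \<noteq> 0 \<longrightarrow> J' = (if w' = w then J else - J))"
proof -
  have re: "Re w = Re w'"
    using arg_cong[OF eq, of qRe] J by (simp add: complex_to_quat_def imag_units_iff)
  then have im: "Im w *\<^sub>R J = Im w' *\<^sub>R J'"
    using eq by (simp add: complex_to_quat_def)
  from arg_cong[OF im, of norm] have "\<bar>Im w\<bar> = \<bar>Im w'\<bar>"
    using J by (simp add: imag_units_iff)
  then consider "Im w' = Im w" | "Im w' = - Im w" "Im w' \<noteq> Im w" by linarith
  then show ?thesis
  proof cases
    case 1
    with im re show ?thesis by (auto simp: complex_eq_iff)
  next
    case 2
    then have "Im w *\<^sub>R J = Im w *\<^sub>R (- J')" using im by simp
    then have "Im w \<noteq> 0 \<longrightarrow> J = - J'" by (metis scaleR_cancel_left)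
    with 2 re show ?thesis by (auto simp: complex_eq_iff)
  qed
qed

definition cnj_on :: "'n set \<Rightarrow> complex ^ 'n \<Rightarrow> complex ^ 'n" where
  "cnj_on A z = (\<chi> i. if i \<in> A then cnj (z $ i) else z $ i)"

text \<open>
  The parity condition of a stem function without continuity: it is all that well-definedness of
  slice functions uses, and it passes to spherical derivatives on the domain where these are
  defined.
\<close>

definition stem_symmetric :: "(complex ^ 'n) set \<Rightarrow> (complex ^ 'n \<Rightarrow> quat ^ 'n set) \<Rightarrow> bool" where
  "stem_symmetric D F \<longleftrightarrow> invariant_dom D \<and>
    (\<forall>z\<in>D. \<forall>K h. F (cnj_at h z) $ K = (-1) ^ card (K \<inter> {h}) * F z $ K)"

lemma stem_function_iff: "stem_function D F \<longleftrightarrow> stem_symmetric D F \<and> continuous_on D F"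
  by (auto simp: stem_function_def stem_symmetric_def)

lemma stem_symmetric_cnj_on:
  fixes F :: "complex ^ 'n::finite \<Rightarrow> quat ^ 'n set"
  assumes F: "stem_symmetric D F" and z: "z \<in> D"
  shows "cnj_on A z \<in> D \<and> F (cnj_on A z) $ K = (-1) ^ card (K \<inter> A) * F z $ K"
  using finite[of A]
proof (induction rule: finite_induct)
  case empty
  have "cnj_on {} z = z" by (simp add: cnj_on_def vec_eq_iff)
  then show ?case using z by simp
next
  case (insert h A)
  have eq: "cnj_on (insert h A) z = cnj_at h (cnj_on A z)"
    using insert.hyps by (auto simp: cnj_on_def cnj_at_def vec_eq_iff)
  have "K \<inter> insert h A = (K \<inter> {h}) \<union> (K \<inter> A)" by auto
  moreover have "(K \<inter> {h}) \<inter> (K \<inter> A) = {}" using insert.hyps by auto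
  ultimately have "card (K \<inter> insert h A) = card (K \<inter> {h}) + card (K \<inter> A)"
    by (metis card_Un_disjoint finite)
  then show ?case
    using F insert.IH unfolding eq stem_symmetric_def invariant_dom_def
    by (auto simp: power_add mult.assoc)
qed

text \<open>
  The component is odd under conjugation of the \<open>k\<close>-th coordinate, which here fixes the point.
\<close>

lemma stem_symmetric_real_zero:
  assumes F: "stem_symmetric D F" and z: "z \<in> D" and k: "k \<in> K" "Im (z $ k) = 0"
  shows "F z $ K = 0"
proof -
  have "cnj_at k z = z"
    using k by (auto simp: cnj_at_def vec_eq_iff complex_eq_iff)
  moreover have "K \<inter> {k} = {k}" using k by auto
  moreover have "F (cnj_at k z) $ K = (-1) ^ card (K \<inter> {k}) * F z $ K"
    using F z unfolding stem_symmetric_def by blast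
  ultimately have "F z $ K = - (F z $ K)"
    by simp
  then show ?thesis
    by (simp add: quat_eq_iff)
qed

text \<open>
  Two representations of a coordinate differ by conjugating \<open>z\<^sub>h\<close> and changing the sign of \<open>J\<^sub>h\<close>, or,
  where the coordinate is real, by an arbitrary change of \<open>J\<^sub>h\<close>. In the first case both factors of
  a summand with \<open>h \<in> K\<close> change sign; in the second case the summands with \<open>h \<in> K\<close> vanish.
\<close>

lemma slice_of_slice_point:
  fixes F :: "complex ^ 'n::{finite,linorder} \<Rightarrow> quat ^ 'n set"
  assumes F: "stem_symmetric D F" and z: "z \<in> D" and J: "\<forall>h. J $ h \<in> imag_units"
  shows "slice_of D F (slice_point J z) = (\<Sum>K\<in>UNIV. oprod K (\<lambda>k. J $ k) * F z $ K)"
  unfolding slice_of_def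
proof (rule the_equality)
  show "\<exists>J' z'. z' \<in> D \<and> (\<forall>h. J' $ h \<in> imag_units) \<and> slice_point J z = slice_point J' z' \<and>
      (\<Sum>K\<in>UNIV. oprod K (\<lambda>k. J $ k) * F z $ K) = (\<Sum>K\<in>UNIV. oprod K (\<lambda>k. J' $ k) * F z' $ K)"
    using z J by blast
next
  fix y
  assume "\<exists>J' z'. z' \<in> D \<and> (\<forall>h. J' $ h \<in> imag_units) \<and> slice_point J z = slice_point J' z' \<and>
      y = (\<Sum>K\<in>UNIV. oprod K (\<lambda>k. J' $ k) * F z' $ K)"
  then obtain J' z' where z': "z' \<in> D" and J': "\<forall>h. J' $ h \<in> imag_units"
    and eq: "slice_point J z = slice_point J' z'" and y: "y = (\<Sum>K\<in>UNIV. oprod K (\<lambda>k. J' $ k) * F z' $ K)"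
    by blast
  have coord: "(z' $ h = z $ h \<or> z' $ h = cnj (z $ h)) \<and>
      (Im (z $ h) \<noteq> 0 \<longrightarrow> J' $ h = (if z' $ h = z $ h then J $ h else - J $ h))" for h
    using complex_to_quat_eq_iff[of "J $ h" "J' $ h" "z $ h" "z' $ h"] J J' arg_cong[OF eq, of "\<lambda>x. x $ h"]
    by (simp add: slice_point_nth)
  define A where "A = {h. z' $ h \<noteq> z $ h}"
  have z'_eq: "z' = cnj_on A z"
    using coord by (auto simp: cnj_on_def A_def vec_eq_iff)
  have "oprod K (\<lambda>k. J' $ k) * F z' $ K = oprod K (\<lambda>k. J $ k) * F z $ K" for K
  proof (cases "\<exists>k\<in>K. Im (z $ k) = 0")
    case True
    then obtain k where k: "k \<in> K" "Im (z $ k) = 0" by blast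
    moreover have "Im (z' $ k) = 0" using k coord[of k] by auto
    ultimately have "F z $ K = 0" "F z' $ K = 0"
      using stem_symmetric_real_zero[OF F z, of k K] stem_symmetric_real_zero[OF F z', of k K] by blast+
    then show ?thesis by simp
  next
    case False
    have "oprod K (\<lambda>k. J' $ k) = oprod K (\<lambda>k. (if k \<in> A then -1 else 1) *\<^sub>R J $ k)"
    proof (rule oprod_cong)
      fix k assume "k \<in> K"
      then have "J' $ k = (if z' $ k = z $ k then J $ k else - J $ k)"
        using False coord[of k] by blast
      then show "J' $ k = (if k \<in> A then -1 else 1) *\<^sub>R J $ k"
        by (cases "k \<in> A") (simp_all add: A_def)
    qed
    also have "\<dots> = (\<Prod>k\<in>K. if k \<in> A then -1 else 1) *\<^sub>R oprod K (\<lambda>k. J $ k)"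
      by (rule oprod_scaleR) simp
    also have "(\<Prod>k\<in>K. if k \<in> A then -1 else 1) = ((-1) ^ card (K \<inter> A) :: real)"
      by (simp add: prod.If_cases Int_def)
    finally have 1: "oprod K (\<lambda>k. J' $ k) = (-1) ^ card (K \<inter> A) *\<^sub>R oprod K (\<lambda>k. J $ k)" .
    have 2: "F z' $ K = (-1) ^ card (K \<inter> A) * F z $ K"
      using stem_symmetric_cnj_on[OF F z] z'_eq by blast
    show ?thesis
      unfolding 1 2 by (cases "even (card (K \<inter> A))") simp_all
  qed
  then show "y = (\<Sum>K\<in>UNIV. oprod K (\<lambda>k. J $ k) * F z $ K)"
    unfolding y by simp
qed

text \<open>
  Changing the signs of the \<open>J\<^sub>h\<close> for \<open>h\<close> in a set \<open>A\<close> multiplies the summand of index \<open>K\<close> by the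
  character \<open>(-1)\<^bsup>|K \<inter> A|\<^esup>\<close>; orthogonality of characters separates the summands.
\<close>

lemma stem_components_unique:
  fixes u v :: "(quat, 'n::{finite,linorder} set) vec"
  assumes eq: "\<And>J. (\<forall>h. J $ h \<in> imag_units) \<Longrightarrow>
    (\<Sum>K\<in>UNIV. oprod K (\<lambda>k. J $ k) * u $ K) = (\<Sum>K\<in>UNIV. oprod K (\<lambda>k. (J :: quat ^ 'n::_) $ k) * v $ K)"
  shows "u = v"
proof -
  obtain j where j: "j \<in> imag_units" using ex_imag_unit by blast
  define c where "c K = oprod K (\<lambda>k::'n. j) * (u $ K - v $ K)" for K
  have flip: "(\<Sum>K\<in>UNIV. (-1) ^ card (K \<inter> A) *\<^sub>R c K) = 0" for A
  proof -
    let ?J = "\<chi> h::'n. if h \<in> A then - j else j"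
    have "oprod K (\<lambda>k. ?J $ k) = (-1) ^ card (K \<inter> A) *\<^sub>R oprod K (\<lambda>k. j)" for K
    proof -
      have "oprod K (\<lambda>k. ?J $ k) = oprod K (\<lambda>k. (if k \<in> A then -1 else 1) *\<^sub>R j)"
        by (intro oprod_cong) auto
      also have "\<dots> = (\<Prod>k\<in>K. if k \<in> A then -1 else 1) *\<^sub>R oprod K (\<lambda>k. j)"
        by (rule oprod_scaleR) simp
      also have "(\<Prod>k\<in>K. if k \<in> A then -1 else 1) = ((-1) ^ card (K \<inter> A) :: real)"
        by (simp add: prod.If_cases Int_def)
      finally show ?thesis .
    qed
    moreover have "(\<Sum>K\<in>UNIV. oprod K (\<lambda>k. ?J $ k) * u $ K) - (\<Sum>K\<in>UNIV. oprod K (\<lambda>k. ?J $ k) * v $ K) = 0"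
      using eq[of ?J] j uminus_imag_units by simp
    ultimately show ?thesis
      by (simp add: c_def right_diff_distrib scaleR_right_diff_distrib sum_subtractf)
  qed
  have "c L = 0" for L
  proof -
    have "0 = (\<Sum>A\<in>UNIV. (-1) ^ card (L \<inter> A) *\<^sub>R (\<Sum>K\<in>UNIV. (-1) ^ card (K \<inter> A) *\<^sub>R c K))"
      by (simp add: flip)
    also have "\<dots> = (\<Sum>K\<in>UNIV. (\<Sum>A\<in>UNIV. (-1) ^ card (L \<inter> A) * (-1) ^ card (K \<inter> A)) *\<^sub>R c K)"
      unfolding scaleR_sum_right scaleR_sum_left scaleR_scaleR by (rule sum.swap)
    also have "\<dots> = (\<Sum>K\<in>UNIV. if K = L then 2 ^ CARD('n) *\<^sub>R c L else 0)"
      unfolding subset_characters_orthogonal by (intro sum.cong) auto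
    also have "\<dots> = 2 ^ CARD('n) *\<^sub>R c L" by simp
    finally show ?thesis by simp
  qed
  moreover have "oprod K (\<lambda>k::'n. j) \<noteq> 0" for K
    by (rule oprod_neq_0) (simp_all add: imag_units_neq_0[OF j])
  ultimately show ?thesis
    by (simp add: c_def vec_eq_iff)
qed

lemma circularization_UNIV: "circularization UNIV = UNIV"
proof (intro set_eqI iffI UNIV_I)
  fix x :: "(quat, 'a) vec"
  show "x \<in> circularization UNIV"
    using ex_slice_point[of x] unfolding circularization_def by blast
qed

lemma stem_of_eqI:
  fixes G :: "complex ^ 'n::{finite,linorder} \<Rightarrow> quat ^ 'n set"
  assumes G: "stem_function UNIV G" and f: "\<And>x. f x = slice_of UNIV G x"
  shows "stem_of UNIV f = G"
  unfolding stem_of_def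
proof (rule some_equality)
  show "stem_function UNIV G \<and> (\<forall>x\<in>circularization UNIV. f x = slice_of UNIV G x)"
    using G f by simp
next
  fix F
  assume "stem_function UNIV F \<and> (\<forall>x\<in>circularization UNIV. f x = slice_of UNIV F x)"
  then have F: "stem_function UNIV F" and eq: "\<And>x. slice_of UNIV F x = slice_of UNIV G x"
    using f by (auto simp: circularization_UNIV)
  show "F = G"
  proof
    fix z
    show "F z = G z"
    proof (rule stem_components_unique)
      fix J :: "quat ^ 'n::_"
      assume J: "\<forall>h. J $ h \<in> imag_units"
      show "(\<Sum>K\<in>UNIV. oprod K (\<lambda>k. J $ k) * F z $ K) = (\<Sum>K\<in>UNIV. oprod K (\<lambda>k. J $ k) * G z $ K)"
        using eq[of "slice_point J z"] F G J by (simp add: slice_of_slice_point stem_function_iff)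
    qed
  qed
qed


section \<open>Stem functions of polynomials\<close>

text \<open>
  The components of \<open>w\<^sub>1 \<otimes> \<dots> \<otimes> w\<^sub>n\<close> in the basis \<open>e\<^sub>K\<close> of \<open>\<complex> \<otimes> \<dots> \<otimes> \<complex>\<close>.
\<close>

definition mono_comp :: "('n::finite \<Rightarrow> complex) \<Rightarrow> 'n set \<Rightarrow> real" where
  "mono_comp w K = (\<Prod>i\<in>UNIV. if i \<in> K then Im (w i) else Re (w i))"

text \<open>
  Multiplication in the tensor product is coordinatewise; for one index the four choices
  \<open>i \<in> K\<close>, \<open>i \<in> L\<close> are the four products in the real and imaginary part of \<open>v\<^sub>i w\<^sub>i\<close>.
\<close>

lemma mono_comp_mult:
  "(\<Sum>K\<in>UNIV. (-1) ^ card (sym_diff K L \<inter> K) * (mono_comp v K * mono_comp w (sym_diff K L)))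
    = mono_comp (\<lambda>i. v i * w i) L"
proof -
  have "(-1) ^ card (sym_diff K L \<inter> K) * (mono_comp v K * mono_comp w (sym_diff K L)) =
      (\<Prod>i\<in>UNIV. if i \<in> K then (if i \<in> L then Im (v i) * Re (w i) else - (Im (v i) * Im (w i)))
        else (if i \<in> L then Re (v i) * Im (w i) else Re (v i) * Re (w i)))" for K
    unfolding mono_comp_def sign_card_eq_prod prod.distrib[symmetric]
    by (intro prod.cong) auto
  then have "(\<Sum>K\<in>UNIV. (-1) ^ card (sym_diff K L \<inter> K) * (mono_comp v K * mono_comp w (sym_diff K L))) =
      (\<Prod>i\<in>UNIV. (if i \<in> L then Im (v i) * Re (w i) else - (Im (v i) * Im (w i)))
        + (if i \<in> L then Re (v i) * Im (w i) else Re (v i) * Re (w i)))"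
    by (simp only: sum_subsets_prod)
  also have "\<dots> = mono_comp (\<lambda>i. v i * w i) L"
    unfolding mono_comp_def by (intro prod.cong) simp_all
  finally show ?thesis .
qed

lemma stem_mult_nth:
  fixes F G :: "complex ^ 'n::finite \<Rightarrow> quat ^ 'n set"
  shows "stem_mult F G z $ L =
    (\<Sum>K\<in>UNIV. (-1) ^ card (sym_diff K L \<inter> K) *\<^sub>R (F z $ K * G z $ sym_diff K L))"
proof -
  have "stem_mult F G z $ L = (\<Sum>H\<in>UNIV. \<Sum>K\<in>UNIV. (if L = sym_diff K H then (-1) ^ card (H \<inter> K) *\<^sub>R (F z $ K * G z $ H) else 0))"
    by (simp add: stem_mult_def axis_def if_distrib cong: if_cong)
  also have "\<dots> = (\<Sum>K\<in>UNIV. \<Sum>H\<in>UNIV. (if H = sym_diff K L then (-1) ^ card (H \<inter> K) *\<^sub>R (F z $ K * G z $ H) else 0))"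
  proof (subst sum.swap, intro sum.cong refl)
    fix K H :: "'n set"
    have "L = sym_diff K H \<longleftrightarrow> H = sym_diff K L" by auto
    then show "(if L = sym_diff K H then (-1) ^ card (H \<inter> K) *\<^sub>R (F z $ K * G z $ H) else 0) =
        (if H = sym_diff K L then (-1) ^ card (H \<inter> K) *\<^sub>R (F z $ K * G z $ H) else 0)"
      by (simp only:)
  qed
  finally show ?thesis by simp
qed

text \<open>
  The stem function of the polynomial with terms \<open>x\<^bsup>m l\<^esup> c\<^sub>l\<close>. Exponents and coefficients are indexed
  by an arbitrary set, so that the exponents can be shifted while the terms keep their labels.
\<close>

definition poly_stem :: "'a set \<Rightarrow> ('a \<Rightarrow> 'n \<Rightarrow> nat) \<Rightarrow> ('a \<Rightarrow> quat) \<Rightarrow> complex ^ 'n::finite \<Rightarrow> quat ^ 'n set" where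
  "poly_stem S m c z = (\<chi> K. \<Sum>l\<in>S. mono_comp (\<lambda>i. (z $ i) ^ m l i) K *\<^sub>R c l)"

lemma stem_mult_poly_stem:
  fixes m0 :: "'b \<Rightarrow> 'n::finite \<Rightarrow> nat" and m :: "'a \<Rightarrow> 'n \<Rightarrow> nat"
  shows "stem_mult (poly_stem {l0} m0 (\<lambda>_. 1)) (poly_stem S m c) = poly_stem S (\<lambda>l i. m0 l0 i + m l i) c"
proof (intro ext, subst vec_eq_iff, intro allI)
  fix z :: "complex ^ 'n" and L :: "'n set"
  let ?v = "\<lambda>i. (z $ i) ^ m0 l0 i" and ?w = "\<lambda>l i. (z $ i) ^ m l i"
  have "stem_mult (poly_stem {l0} m0 (\<lambda>_. 1)) (poly_stem S m c) z $ L =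
      (\<Sum>K\<in>UNIV. \<Sum>l\<in>S. ((-1) ^ card (sym_diff K L \<inter> K) * (mono_comp ?v K * mono_comp (?w l) (sym_diff K L))) *\<^sub>R c l)"
    by (simp add: stem_mult_nth poly_stem_def scaleR_sum_right)
  also have "\<dots> = (\<Sum>l\<in>S. (\<Sum>K\<in>UNIV. (-1) ^ card (sym_diff K L \<inter> K) * (mono_comp ?v K * mono_comp (?w l) (sym_diff K L))) *\<^sub>R c l)"
    unfolding scaleR_sum_left by (rule sum.swap)
  also have "\<dots> = poly_stem S (\<lambda>l i. m0 l0 i + m l i) c z $ L"
    unfolding mono_comp_mult by (simp add: poly_stem_def power_add)
  finally show "stem_mult (poly_stem {l0} m0 (\<lambda>_. 1)) (poly_stem S m c) z $ L = poly_stem S (\<lambda>l i. m0 l0 i + m l i) c z $ L" .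
qed

lemma mono_comp_cnj_at:
  "mono_comp (\<lambda>i. (cnj_at h z $ i) ^ m i) K = (-1) ^ card (K \<inter> {h}) * mono_comp (\<lambda>i. (z $ i) ^ m i) K"
  unfolding mono_comp_def sign_card_eq_prod prod.distrib[symmetric]
  by (intro prod.cong) (auto simp: cnj_at_def simp flip: complex_cnj_power)

lemma stem_function_poly_stem:
  fixes m :: "'a \<Rightarrow> 'n::finite \<Rightarrow> nat"
  shows "stem_function UNIV (poly_stem S m c)"
  unfolding stem_function_def invariant_dom_def
proof (intro conjI allI ballI)
  show "continuous_on UNIV (poly_stem S m c)"
    unfolding poly_stem_def
  proof (intro continuous_on_vec_lambda continuous_on_sum continuous_on_scaleR continuous_on_const)
    fix K :: "'n set" and l
    have "continuous_on UNIV (\<lambda>z::complex^'n. if i \<in> K then Im ((z $ i) ^ m l i) else Re ((z $ i) ^ m l i))" for i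
      by (cases "i \<in> K") (auto intro!: continuous_intros)
    then show "continuous_on UNIV (\<lambda>z. mono_comp (\<lambda>i. (z $ i) ^ m l i) K)"
      unfolding mono_comp_def by (intro continuous_on_prod) simp
  qed
  fix z :: "complex ^ 'n" and K :: "'n set" and h
  have "(-1) ^ card (K \<inter> {h}) * (\<Sum>l\<in>S. mono_comp (\<lambda>i. (z $ i) ^ m l i) K *\<^sub>R c l) =
      (-1) ^ card (K \<inter> {h}) *\<^sub>R (\<Sum>l\<in>S. mono_comp (\<lambda>i. (z $ i) ^ m l i) K *\<^sub>R c l)"
    by (cases "even (card (K \<inter> {h}))") simp_all
  then show "poly_stem S m c (cnj_at h z) $ K = (-1) ^ card (K \<inter> {h}) * poly_stem S m c z $ K"
    by (simp add: poly_stem_def mono_comp_cnj_at scaleR_sum_right)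
qed simp

lemma slice_of_poly_stem:
  fixes m :: "'a \<Rightarrow> 'n::{finite,linorder} \<Rightarrow> nat"
  shows "slice_of UNIV (poly_stem S m c) x = (\<Sum>l\<in>S. oprod UNIV (\<lambda>i. (x $ i) ^ m l i) * c l)"
proof -
  obtain J z where J: "\<forall>h. J $ h \<in> imag_units" and x: "x = slice_point J z"
    using ex_slice_point by blast
  have power: "(x $ i) ^ k = Re ((z $ i) ^ k) *\<^sub>R 1 + Im ((z $ i) ^ k) *\<^sub>R J $ i" for i k
    using complex_to_quat_power[of "J $ i" "z $ i" k] J by (simp add: x slice_point_nth complex_to_quat_def)
  have mono: "oprod UNIV (\<lambda>i. (x $ i) ^ m l i) = (\<Sum>K\<in>UNIV. mono_comp (\<lambda>i. (z $ i) ^ m l i) K *\<^sub>R oprod K (\<lambda>k. J $ k))" for l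
  proof -
    have "oprod UNIV (\<lambda>i. (x $ i) ^ m l i) = oprod UNIV (\<lambda>i. Re ((z $ i) ^ m l i) *\<^sub>R 1 + Im ((z $ i) ^ m l i) *\<^sub>R J $ i)"
      by (simp only: power)
    also have "\<dots> = (\<Sum>K\<in>UNIV. mono_comp (\<lambda>i. (z $ i) ^ m l i) K *\<^sub>R oprod K (\<lambda>k. J $ k))"
      by (simp add: oprod_add_expand mono_comp_def)
    finally show ?thesis .
  qed
  have "slice_of UNIV (poly_stem S m c) x = (\<Sum>K\<in>UNIV. oprod K (\<lambda>k. J $ k) * poly_stem S m c z $ K)"
    unfolding x by (rule slice_of_slice_point) (use stem_function_poly_stem J in \<open>auto simp: stem_function_iff\<close>)
  also have "\<dots> = (\<Sum>K\<in>UNIV. \<Sum>l\<in>S. mono_comp (\<lambda>i. (z $ i) ^ m l i) K *\<^sub>R oprod K (\<lambda>k. J $ k) * c l)"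
    by (simp add: poly_stem_def sum_distrib_left)
  also have "\<dots> = (\<Sum>l\<in>S. oprod UNIV (\<lambda>i. (x $ i) ^ m l i) * c l)"
    unfolding mono sum_distrib_right by (rule sum.swap)
  finally show ?thesis .
qed

lemma stem_of_poly: "stem_of UNIV (\<lambda>x. \<Sum>l\<in>S. oprod UNIV (\<lambda>i. (x $ i) ^ m l i) * c l) = poly_stem S m c"
  by (rule stem_of_eqI[OF stem_function_poly_stem]) (simp only: slice_of_poly_stem)

lemma coord_eq: "coord j x = x $ j"
proof -
  have sym: "stem_symmetric UNIV (coord_stem j)"
    unfolding stem_symmetric_def invariant_dom_def
  proof (intro conjI allI ballI)
    fix z h and K :: "'a set"
    show "coord_stem j (cnj_at h z) $ K = (-1) ^ card (K \<inter> {h}) * coord_stem j z $ K"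
      by (cases "h = j") (auto simp: coord_stem_def axis_def cnj_at_def)
  qed simp
  obtain J z where J: "\<forall>h. J $ h \<in> imag_units" and x: "x = slice_point J z"
    using ex_slice_point by blast
  have "coord j x = (\<Sum>K\<in>UNIV. oprod K (\<lambda>k. J $ k) * coord_stem j z $ K)"
    unfolding coord_def x by (rule slice_of_slice_point[OF sym _ J]) simp
  also have "\<dots> = (\<Sum>K\<in>UNIV. (if K = {} then of_real (Re (z $ j)) else 0) + (if K = {j} then J $ j * of_real (Im (z $ j)) else 0))"
    by (intro sum.cong refl) (auto simp: coord_stem_def axis_def oprod_def)
  also have "\<dots> = x $ j"
    by (simp add: sum.distrib x slice_point_def)
  finally show ?thesis .
qed

lemma coord_prod_eq: "coord_prod K x = oprod UNIV (\<lambda>i. (x $ i) ^ (if i \<in> K then 1 else 0))"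
proof -
  have "coord_prod K x = oprod K (\<lambda>i. x $ i)"
    by (simp add: coord_prod_def coord_eq)
  also have "\<dots> = oprod UNIV (\<lambda>i. if i \<in> K then x $ i else 1)"
    by (rule oprod_extend_by_one[symmetric]) simp_all
  also have "\<dots> = oprod UNIV (\<lambda>i. (x $ i) ^ (if i \<in> K then 1 else 0))"
    by (rule oprod_cong) simp
  finally show ?thesis .
qed

text \<open>
  As a polynomial, \<open>x\<^sub>K\<close> has the single exponent \<open>\<chi>\<^sub>K\<close>.
\<close>

lemma slice_mult_coord_prod_poly:
  "slice_mult UNIV (coord_prod K) (\<lambda>x. \<Sum>l\<in>S. oprod UNIV (\<lambda>i. (x $ i) ^ m l i) * c l) =
    (\<lambda>x. \<Sum>l\<in>S. oprod UNIV (\<lambda>i. (x $ i) ^ ((if i \<in> K then 1 else 0) + m l i)) * c l)"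
proof -
  have "coord_prod K = (\<lambda>x. \<Sum>l\<in>{()}. oprod UNIV (\<lambda>i. (x $ i) ^ (if i \<in> K then 1 else 0)) * 1)"
    by (rule ext) (simp add: coord_prod_eq)
  then have "stem_of UNIV (coord_prod K) = poly_stem {()} (\<lambda>_ i. if i \<in> K then 1 else 0) (\<lambda>_. 1)"
    by (simp only: stem_of_poly)
  then show ?thesis
    unfolding slice_mult_def stem_of_poly
    by (intro ext) (simp only: stem_mult_poly_stem slice_of_poly_stem)
qed

text \<open>
  The powers of \<open>w\<close> satisfy \<open>w\<^bsup>m+2\<^esup> = 2 Re w w\<^bsup>m+1\<^esup> - |w|\<^sup>2 w\<^sup>m\<close>, and both real part and modulus are the
  same for \<open>w\<close> and its image in the quaternions.
\<close>

lemma Im_power_eq_spherical_chebyshev: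
  assumes J: "J \<in> imag_units"
  shows "Im (w ^ m) = Im w * spherical_chebyshev m (complex_to_quat J w)"
proof (induction m rule: induct_nat_012)
  case (ge2 m)
  let ?x = "complex_to_quat J w"
  have "J \<bullet> J = 1" "1 \<bullet> J = 0" "J \<bullet> 1 = 0"
    using J by (simp_all add: imag_units_iff norm_eq_1) (simp_all add: inner_quat_def)
  then have x: "?x \<bullet> ?x = Re w * Re w + Im w * Im w"
    by (simp add: complex_to_quat_def inner_add_left inner_add_right) (simp add: inner_quat_def)
  have re: "qRe ?x = Re w"
    using J by (simp add: complex_to_quat_def imag_units_iff)
  have "w ^ Suc (Suc m) = of_real (2 * Re w) * w ^ Suc m - of_real (Re w * Re w + Im w * Im w) * w ^ m"
  proof -
    have "w * w = of_real (2 * Re w) * w - of_real (Re w * Re w + Im w * Im w)"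
      by (simp add: complex_eq_iff algebra_simps)
    then have "w * w * w ^ m = (of_real (2 * Re w) * w - of_real (Re w * Re w + Im w * Im w)) * w ^ m"
      by simp
    then show ?thesis by (simp only: power_Suc left_diff_distrib mult.assoc)
  qed
  moreover have "Im (of_real r * v) = r * Im v" for r v
    by simp
  ultimately have "Im (w ^ Suc (Suc m)) = 2 * Re w * Im (w ^ Suc m) - (Re w * Re w + Im w * Im w) * Im (w ^ m)"
    by (simp only: minus_complex.sel)
  then show ?case
    unfolding spherical_chebyshev.simps ge2 x re by (simp add: algebra_simps)
qed simp_all

section \<open>Spherical derivatives and components of polynomials\<close>

lemma stem_deriv_nth:
  "stem_deriv H F z $ K = (if K \<subseteq> - H then inverse (\<Prod>h\<in>H. Im (z $ h)) *\<^sub>R F z $ (K \<union> H) else 0)"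
proof -
  have "(\<Sum>L\<in>Pow (- H). axis L (F z $ (L \<union> H))) $ K = (\<Sum>L\<in>Pow (- H). if L = K then F z $ (K \<union> H) else 0)"
    by (simp add: axis_def)
  also have "\<dots> = (if K \<subseteq> - H then F z $ (K \<union> H) else 0)"
    by (subst sum.delta) auto
  finally show ?thesis by (simp add: stem_deriv_def)
qed

lemma stem_symmetric_stem_deriv:
  fixes F :: "complex ^ 'n::finite \<Rightarrow> quat ^ 'n set"
  assumes F: "stem_symmetric UNIV F"
  shows "stem_symmetric (nonreal_dom H) (stem_deriv H F)"
  unfolding stem_symmetric_def
proof (intro conjI ballI allI)
  show "invariant_dom (nonreal_dom H)"
    by (auto simp: invariant_dom_def nonreal_dom_def cnj_at_def split: if_splits)
  fix z :: "complex ^ 'n" and K h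
  have prod: "(\<Prod>j\<in>H. Im (cnj_at h z $ j)) = (-1) ^ card (H \<inter> {h}) * (\<Prod>j\<in>H. Im (z $ j))"
  proof -
    have "(\<Prod>j\<in>H. Im (cnj_at h z $ j)) = (\<Prod>j\<in>H. (if j = h then -1 else 1) * Im (z $ j))"
      by (intro prod.cong) (auto simp: cnj_at_def)
    also have "\<dots> = (-1) ^ card (H \<inter> {h}) * (\<Prod>j\<in>H. Im (z $ j))"
      by (simp add: prod.distrib prod.If_cases)
    finally show ?thesis .
  qed
  have sign: "F (cnj_at h z) $ (K \<union> H) = (-1) ^ card ((K \<union> H) \<inter> {h}) * F z $ (K \<union> H)"
    using F by (simp add: stem_symmetric_def)
  show "stem_deriv H F (cnj_at h z) $ K = (-1) ^ card (K \<inter> {h}) * stem_deriv H F z $ K"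
  proof (cases "K \<subseteq> - H")
    case True
    show ?thesis
    proof (cases "h \<in> H")
      case h: True
      then have "H \<inter> {h} = {h}" "K \<inter> {h} = {}" "(K \<union> H) \<inter> {h} = {h}" using True by auto
      then show ?thesis using True by (simp add: stem_deriv_nth prod sign)
    next
      case False
      then have "H \<inter> {h} = {}" "(K \<union> H) \<inter> {h} = K \<inter> {h}" by auto
      then show ?thesis using True by (simp add: stem_deriv_nth prod sign)
    qed
  qed (simp add: stem_deriv_nth)
qed

text \<open>
  The right-hand side of the claim, with exponents \<open>m l\<close> already containing the shift by \<open>\<chi>\<^sub>K\<close>.
\<close>

definition component_poly ::
    "'n::{finite,linorder} set \<Rightarrow> 'a set \<Rightarrow> ('a \<Rightarrow> 'n \<Rightarrow> nat) \<Rightarrow> ('a \<Rightarrow> quat) \<Rightarrow> quat ^ 'n::{finite,linorder} \<Rightarrow> quat" where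
  "component_poly H S m c x =
    (\<Sum>l\<in>S. (\<Prod>j\<in>H. spherical_chebyshev (m l j) (x $ j)) *\<^sub>R (oprod (- H) (\<lambda>i. (x $ i) ^ m l i) * c l))"

lemma mono_comp_union:
  assumes "K \<subseteq> - H"
  shows "mono_comp w (K \<union> H) = (\<Prod>h\<in>H. Im (w h)) * (\<Prod>i\<in>- H. if i \<in> K then Im (w i) else Re (w i))"
proof -
  have "mono_comp w (K \<union> H) = (\<Prod>i\<in>H \<union> - H. if i \<in> K \<union> H then Im (w i) else Re (w i))"
    by (simp add: mono_comp_def)
  also have "\<dots> = (\<Prod>i\<in>H. if i \<in> K \<union> H then Im (w i) else Re (w i)) * (\<Prod>i\<in>- H. if i \<in> K \<union> H then Im (w i) else Re (w i))"
    by (rule prod.union_disjoint) auto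
  also have "(\<Prod>i\<in>H. if i \<in> K \<union> H then Im (w i) else Re (w i)) = (\<Prod>h\<in>H. Im (w h))"
    by (intro prod.cong) auto
  also have "(\<Prod>i\<in>- H. if i \<in> K \<union> H then Im (w i) else Re (w i)) = (\<Prod>i\<in>- H. if i \<in> K then Im (w i) else Re (w i))"
    by (intro prod.cong) auto
  finally show ?thesis .
qed

text \<open>
  In the component of index \<open>K \<union> H\<close> the factors \<open>Im z\<^sub>h\<^sup>m\<close> with \<open>h \<in> H\<close> split off; divided by \<open>Im z\<^sub>h\<close> they
  become real valued functions of \<open>x\<^sub>h\<close> alone. The sum over \<open>K\<close> then reassembles the ordered product over
  the complement of \<open>H\<close>.
\<close>

lemma spherical_deriv_poly:
  fixes m :: "'a \<Rightarrow> 'n::{finite,linorder} \<Rightarrow> nat"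
  assumes x: "x \<in> circularization (nonreal_dom H)"
  shows "spherical_deriv H (\<lambda>x. \<Sum>l\<in>S. oprod UNIV (\<lambda>i. (x $ i) ^ m l i) * c l) x = component_poly H S m c x"
proof -
  obtain J z where z: "z \<in> nonreal_dom H" and J: "\<forall>h. J $ h \<in> imag_units" and x: "x = slice_point J z"
    using x unfolding circularization_def by blast
  let ?p = "\<Prod>h\<in>H. Im (z $ h)"
  let ?C = "\<lambda>l. \<Prod>j\<in>H. spherical_chebyshev (m l j) (x $ j)"
  let ?M = "\<lambda>l K. \<Prod>i\<in>- H. if i \<in> K then Im ((z $ i) ^ m l i) else Re ((z $ i) ^ m l i)"
  have p: "?p \<noteq> 0" using z by (simp add: nonreal_dom_def)
  have im: "(\<Prod>h\<in>H. Im ((z $ h) ^ m l h)) = ?p * ?C l" for l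
  proof -
    have "Im ((z $ h) ^ m l h) = Im (z $ h) * spherical_chebyshev (m l h) (x $ h)" for h
      using J by (simp add: Im_power_eq_spherical_chebyshev[of "J $ h"] x slice_point_nth)
    then show ?thesis by (simp add: prod.distrib)
  qed
  have comp: "stem_deriv H (poly_stem S m c) z $ K = (\<Sum>l\<in>S. (?C l * ?M l K) *\<^sub>R c l)" if "K \<in> Pow (- H)" for K
  proof -
    have cancel: "inverse ?p * (?p * b) = b" for b using p by simp
    show ?thesis
      using that by (simp add: cancel stem_deriv_nth poly_stem_def mono_comp_union im scaleR_sum_right mult.assoc del: prod_zero_iff)
  qed
  have power: "(x $ i) ^ k = Re ((z $ i) ^ k) *\<^sub>R 1 + Im ((z $ i) ^ k) *\<^sub>R J $ i" for i k
    using complex_to_quat_power[of "J $ i" "z $ i" k] J by (simp add: x slice_point_nth complex_to_quat_def)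
  have mono: "oprod (- H) (\<lambda>i. (x $ i) ^ m l i) = (\<Sum>K\<in>Pow (- H). ?M l K *\<^sub>R oprod K (\<lambda>k. J $ k))" for l
  proof -
    have "oprod (- H) (\<lambda>i. (x $ i) ^ m l i) = oprod (- H) (\<lambda>i. Re ((z $ i) ^ m l i) *\<^sub>R 1 + Im ((z $ i) ^ m l i) *\<^sub>R J $ i)"
      by (simp only: power)
    then show ?thesis
      by (simp only: oprod_add_expand[OF finite])
  qed
  have sym: "stem_symmetric UNIV (poly_stem S m c)"
    using stem_function_poly_stem[of S m c] by (simp add: stem_function_iff)
  have "spherical_deriv H (\<lambda>x. \<Sum>l\<in>S. oprod UNIV (\<lambda>i. (x $ i) ^ m l i) * c l) x =
      (\<Sum>K\<in>UNIV. oprod K (\<lambda>k. J $ k) * stem_deriv H (poly_stem S m c) z $ K)"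
    unfolding spherical_deriv_def stem_of_poly x
    by (rule slice_of_slice_point[OF stem_symmetric_stem_deriv[OF sym] z J])
  also have "\<dots> = (\<Sum>K\<in>Pow (- H). oprod K (\<lambda>k. J $ k) * stem_deriv H (poly_stem S m c) z $ K)"
    by (rule sum.mono_neutral_right) (auto simp: stem_deriv_nth)
  also have "\<dots> = (\<Sum>K\<in>Pow (- H). \<Sum>l\<in>S. ?C l *\<^sub>R ((?M l K *\<^sub>R oprod K (\<lambda>k. J $ k)) * c l))"
    by (intro sum.cong refl) (simp add: comp sum_distrib_left)
  also have "\<dots> = component_poly H S m c x"
    unfolding component_poly_def mono sum_distrib_right scaleR_sum_right by (rule sum.swap)
  finally show ?thesis .
qed

lemma continuous_on_oprod:
  fixes f :: "'b::linorder \<Rightarrow> 'a::topological_space \<Rightarrow> 'c::real_normed_algebra_1"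
  assumes "finite A" "\<And>i. i \<in> A \<Longrightarrow> continuous_on S (f i)"
  shows "continuous_on S (\<lambda>x. oprod A (\<lambda>i. f i x))"
  using assms
proof (induction rule: finite_linorder_min_induct)
  case (insert b A)
  then show ?case by (simp add: oprod_insert_less continuous_on_mult)
qed simp

lemma continuous_on_component_poly: "continuous_on UNIV (component_poly H S m c)"
  unfolding component_poly_def
  by (intro continuous_on_sum continuous_on_scaleR continuous_on_prod continuous_on_mult continuous_on_const
      continuous_on_oprod finite continuous_on_power continuous_on_component continuous_on_id
      continuous_on_compose2[OF continuous_on_polynomial[OF polynomial_spherical_chebyshev, of UNIV]]) auto

text \<open>
  A point outside is approached by giving its real coordinates a small imaginary part.
\<close>

lemma islimpt_nonreal_dom:
  fixes x :: "quat ^ 'n::{finite,linorder}"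
  assumes x: "x \<notin> circularization (nonreal_dom H)"
  shows "x islimpt circularization (nonreal_dom H)"
proof -
  obtain J z where J: "\<forall>h. J $ h \<in> imag_units" and z: "x = slice_point J z"
    using ex_slice_point by blast
  define w where "w t = (\<chi> h. if Im (z $ h) = 0 then Complex (Re (z $ h)) t else z $ h)" for t
  have in_dom: "slice_point J (w t) \<in> circularization (nonreal_dom H)" if "t > 0" for t
    using that J by (auto simp: circularization_def nonreal_dom_def w_def intro!: exI[of _ J] exI[of _ "w t"] split: if_splits)
  have lim: "((\<lambda>t. slice_point J (w t)) \<longlongrightarrow> slice_point J (w 0)) (at_right 0)"
  proof (intro vec_tendstoI)
    fix h
    show "((\<lambda>t. slice_point J (w t) $ h) \<longlongrightarrow> slice_point J (w 0) $ h) (at_right 0)"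
      by (cases "Im (z $ h) = 0") (auto simp: slice_point_nth w_def complex_to_quat_def intro!: tendsto_eq_intros)
  qed
  have w0: "w 0 = z"
    by (auto simp: w_def vec_eq_iff complex_eq_iff)
  have "x \<in> closure (circularization (nonreal_dom H))"
  proof (rule Lim_in_closed_set[OF closed_closure _ trivial_limit_at_right_real lim[unfolded w0, folded z]])
    have "eventually (\<lambda>t. 0 < t) (at_right (0::real))"
      by (rule eventually_at_right_less)
    then show "eventually (\<lambda>t. slice_point J (w t) \<in> closure (circularization (nonreal_dom H))) (at_right 0)"
      by eventually_elim (use in_dom closure_subset in blast)
  qed
  with x show ?thesis by (simp add: closure_def)
qed

lemma spherical_component_poly:
  "spherical_component H K (\<lambda>x. \<Sum>l\<in>S. oprod UNIV (\<lambda>i. (x $ i) ^ m l i) * c l) x =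
    component_poly H S (\<lambda>l i. (if i \<in> K then 1 else 0) + m l i) c x"
proof -
  let ?f = "\<lambda>x. \<Sum>l\<in>S. oprod UNIV (\<lambda>i. (x $ i) ^ m l i) * c l"
  let ?R = "component_poly H S (\<lambda>l i. (if i \<in> K then 1 else 0) + m l i) c"
  let ?\<Omega> = "circularization (nonreal_dom H)"
  let ?g = "spherical_deriv H (slice_mult UNIV (coord_prod K) ?f)"
  have g: "?g y = ?R y" if "y \<in> ?\<Omega>" for y
    unfolding slice_mult_coord_prod_poly by (rule spherical_deriv_poly[OF that])
  show ?thesis
  proof (cases "x \<in> ?\<Omega>")
    case True
    then show ?thesis by (simp add: spherical_component_def Let_def g)
  next
    case False
    have "(?R \<longlongrightarrow> ?R x) (at x within ?\<Omega>)"
      using continuous_on_component_poly[of H S "\<lambda>l i. (if i \<in> K then 1 else 0) + m l i" c]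
      unfolding continuous_on_def using tendsto_within_subset by blast
    then have "(?g \<longlongrightarrow> ?R x) (at x within ?\<Omega>)"
      by (rule Lim_transform_eventually) (auto simp: eventually_at_filter g intro!: always_eventually)
    moreover have "at x within ?\<Omega> \<noteq> bot"
      using islimpt_nonreal_dom[OF False] by (simp add: trivial_limit_within)
    ultimately have "Lim (at x within ?\<Omega>) ?g = ?R x"
      by (intro tendsto_Lim)
    then show ?thesis using False by (simp add: spherical_component_def Let_def)
  qed
qed

lemma finite_bounded_degree: "finite {l :: 'n::finite \<Rightarrow> nat. (\<Sum>i\<in>UNIV. l i) \<le> d}"
proof (rule finite_subset)
  show "{l :: 'n \<Rightarrow> nat. (\<Sum>i\<in>UNIV. l i) \<le> d} \<subseteq> PiE UNIV (\<lambda>_. {..d})"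
    by (auto simp: PiE_UNIV_domain) (meson UNIV_I finite le_trans member_le_sum zero_le)
qed (intro finite_PiE, simp_all)

lemma sum_by_degree:
  fixes f :: "('n::finite \<Rightarrow> nat) \<Rightarrow> 'b::comm_monoid_add"
  shows "(\<Sum>k=0..d. \<Sum>l | (\<Sum>i\<in>UNIV. l i) = k. f l) = (\<Sum>l | (\<Sum>i\<in>UNIV. l i) \<le> d. f l)"
proof -
  have "(\<Sum>k=0..d. \<Sum>l | (\<Sum>i\<in>UNIV. l i) = k. f l) =
      (\<Sum>k=0..d. \<Sum>l | l \<in> {l. (\<Sum>i\<in>UNIV. l i) \<le> d} \<and> (\<Sum>i\<in>UNIV. l i) = k. f l)"
    by (intro sum.cong refl) auto
  also have "\<dots> = (\<Sum>l | (\<Sum>i\<in>UNIV. l i) \<le> d. f l)"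
    by (rule sum.group) (auto intro: finite_bounded_degree)
  finally show ?thesis .
qed

theorem proposition4p2:
  fixes a :: "('n::{finite,linorder} \<Rightarrow> nat) \<Rightarrow> quat"
    and d :: nat
    and H K :: "'n set"
    and x :: "quat ^ 'n::{finite,linorder}"
  assumes "K \<subseteq> H"
  shows "spherical_component H K (quat_poly d a) x =
    (\<Sum>k=0..d. \<Sum>l | (\<Sum>i\<in>UNIV. l i) = k.
       of_real (\<Prod>j\<in>H. zonal_tilde (int (l j) - 1 + indicator K j) (x $ j)) *
       oprod (- H) (\<lambda>i. (x $ i) ^ l i) * a l)"
proof -
  let ?S = "{l :: 'n \<Rightarrow> nat. (\<Sum>i\<in>UNIV. l i) \<le> d}"
  have "quat_poly d a = (\<lambda>x. \<Sum>l\<in>?S. oprod UNIV (\<lambda>i. (x $ i) ^ l i) * a l)"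
    unfolding quat_poly_def sum_by_degree ..
  then have "spherical_component H K (quat_poly d a) x = component_poly H ?S (\<lambda>l i. (if i \<in> K then 1 else 0) + l i) a x"
    by (simp only: spherical_component_poly)
  also have "\<dots> = (\<Sum>l\<in>?S. of_real (\<Prod>j\<in>H. zonal_tilde (int (l j) - 1 + indicator K j) (x $ j)) *
       oprod (- H) (\<lambda>i. (x $ i) ^ l i) * a l)"
    unfolding component_poly_def
  proof (intro sum.cong refl)
    fix l :: "'n \<Rightarrow> nat"
    have "zonal_tilde (int (l j) - 1 + indicator K j) (x $ j) = spherical_chebyshev ((if j \<in> K then 1 else 0) + l j) (x $ j)" for j
      unfolding zonal_tilde_eq[symmetric] by (simp add: indicator_def)
    moreover have "oprod (- H) (\<lambda>i. (x $ i) ^ ((if i \<in> K then 1 else 0) + l i)) = oprod (- H) (\<lambda>i. (x $ i) ^ l i)"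
      using assms by (intro oprod_cong) auto
    ultimately show "(\<Prod>j\<in>H. spherical_chebyshev ((if j \<in> K then 1 else 0) + l j) (x $ j)) *\<^sub>R
        (oprod (- H) (\<lambda>i. (x $ i) ^ ((if i \<in> K then 1 else 0) + l i)) * a l) =
      of_real (\<Prod>j\<in>H. zonal_tilde (int (l j) - 1 + indicator K j) (x $ j)) * oprod (- H) (\<lambda>i. (x $ i) ^ l i) * a l"
      by (simp add: scaleR_conv_of_real mult.assoc)
  qed
  finally show ?thesis unfolding sum_by_degree .
qed

end
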